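(* Let $r\geq 1$ and $n\geq r^2+r+2$ be integers, and let $G$ be a bipartite graph on $n$ vertices without isolated vertices such that $b(G)<\frac{1}{r}$. Let $$\rho'=\rho\Big(K_{n-\lfloor\frac{n-1}{r+1}\rfloor,\lfloor\frac{n-1}{r+1}\rfloor}\Big),\qquad \rho''=\rho\Big(D\big(\lceil\tfrac{n-r-1}{2}\rceil,r+1;1,\lfloor\tfrac{n-r-1}{2}\rfloor-1\big)\Big).$$ Then: (i) If $r=1$, then $\rho(G)\leq\rho'$, with equality if and only if $G\cong K_{n-\lfloor\frac{n-1}{2}\rfloor,\lfloor\frac{n-1}{2}\rfloor}$. (ii) If $r\geq 2$ and $\rho'>\rho''$, then $\rho(G)\leq\rho'$, with equality if and only if $G\cong K_{n-\lfloor\frac{n-1}{r+1}\rfloor,\lfloor\frac{n-1}{r+1}\rfloor}$. (iii) If $r\geq 2$ and $\rho'<\rho''$, then $\rho(G)\leq\rho''$, with equality if and only if $G\cong D\big(\lceil\frac{n-r-1}{2}\rceil,r+1;1,\lfloor\frac{n-r-1}{2}\rfloor-1\big)$. (iv) If $r\geq 2$ and $\rho'=\rho''$, then $\rho(G)\leq\rho'$, with equality if and only if $G\in\Big\{K_{n-\lfloor\frac{n-1}{r+1}\rfloor,\lfloor\frac{n-1}{r+1}\rfloor},\ D\big(\lceil\frac{n-r-1}{2}\rceil,r+1;1,\lfloor\frac{n-r-1}{2}\rfloor-1\big)\Big\}$.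
   Context: All graphs are finite and simple; $\rho(G)$ is the largest eigenvalue of the adjacency matrix of $G$. For $S\subseteq V(G)$, $N_G(S)$ is the union of the neighborhoods of vertices in $S$. The binding number of $G$ is $b(G)=\min\{|N_G(S)|/|S|:\emptyset\neq S\subseteq V(G),\ N_G(S)\neq V(G)\}$. $K_{a,b}$ is the complete bipartite graph with parts of sizes $a,b$. For positive integers $p_1,p_2,q_1,q_2$, the double nested graph $D(p_1,p_2;q_1,q_2)$ is the bipartite graph with parts $X=X_1\cup X_2$ and $Y=Y_1\cup Y_2$ (disjoint independent sets with $|X_i|=p_i$, $|Y_i|=q_i$), in which every vertex of $X_1$ is adjacent to every vertex of $Y_1\cup Y_2$, every vertex of $X_2$ is adjacent to every vertex of $Y_1$, and there are no other edges. *)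

theory Defs
  imports
    "Graph_Theory.Graph_Theory"
    "Jordan_Normal_Form.Spectral_Radius"
begin

text \<open>
  Finite simple graphs are the locale \<^const>\<open>pair_graph\<close>: a finite vertex set \<^const>\<open>pverts\<close>
  together with an irreflexive symmetric set \<^const>\<open>parcs\<close> of ordered pairs, each edge
  \<open>uv\<close> being represented by both \<open>(u, v)\<close> and \<open>(v, u)\<close>.
\<close>

definition nbhd :: "'a pair_pre_digraph \<Rightarrow> 'a set \<Rightarrow> 'a set" where
  "nbhd G S = (\<Union>v\<in>S. {u. (v, u) \<in> parcs G})"

definition binding_number :: "'a pair_pre_digraph \<Rightarrow> real" where
  "binding_number G =
     Min {real (card (nbhd G S)) / real (card S) | S.
            S \<noteq> {} \<and> S \<subseteq> pverts G \<and> nbhd G S \<noteq> pverts G}"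

definition bipartite :: "'a pair_pre_digraph \<Rightarrow> bool" where
  "bipartite G \<longleftrightarrow> (\<exists>X Y. pverts G = X \<union> Y \<and> X \<inter> Y = {} \<and> parcs G \<subseteq> X \<times> Y \<union> Y \<times> X)"

definition no_isolated_vertices :: "'a pair_pre_digraph \<Rightarrow> bool" where
  "no_isolated_vertices G \<longleftrightarrow> (\<forall>v\<in>pverts G. nbhd G {v} \<noteq> {})"

definition adjacency_matrix :: "'a pair_pre_digraph \<Rightarrow> 'a list \<Rightarrow> real mat" where
  "adjacency_matrix G vs =
     mat (length vs) (length vs) (\<lambda>(i, j). if (vs ! i, vs ! j) \<in> parcs G then 1 else 0)"

text \<open>
  The rows and columns are indexed by an arbitrary enumeration of the vertices; the lemma
  \<open>spectrum_adjacency_matrix\<close> below shows that the spectrum does not depend on it. Note that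
  \<^const>\<open>spectrum\<close> is here the set of real eigenvalues, and \<^const>\<open>Max\<close> picks the largest one.
\<close>

definition graph_rho :: "'a pair_pre_digraph \<Rightarrow> real" where
  "graph_rho G =
     Max (spectrum (adjacency_matrix G (SOME vs. distinct vs \<and> set vs = pverts G)))"

definition complete_bipartite_graph :: "nat \<Rightarrow> nat \<Rightarrow> (nat + nat) pair_pre_digraph" where
  "complete_bipartite_graph a b =
     (let X = Inl ` {..<a}; Y = Inr ` {..<b}
      in \<lparr> pverts = X \<union> Y, parcs = X \<times> Y \<union> Y \<times> X \<rparr>)"

definition double_nested_graph ::
    "nat \<Rightarrow> nat \<Rightarrow> nat \<Rightarrow> nat \<Rightarrow> (nat + nat) pair_pre_digraph" where
  "double_nested_graph p1 p2 q1 q2 =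
     (let X1 = Inl ` {..<p1}; X2 = Inl ` {p1..<p1 + p2};
          Y1 = Inr ` {..<q1}; Y2 = Inr ` {q1..<q1 + q2};
          E = X1 \<times> (Y1 \<union> Y2) \<union> X2 \<times> Y1
      in \<lparr> pverts = X1 \<union> X2 \<union> Y1 \<union> Y2, parcs = E \<union> E\<inverse> \<rparr>)"

abbreviation graph_iso :: "'a pair_pre_digraph \<Rightarrow> 'b pair_pre_digraph \<Rightarrow> bool" where
  "graph_iso G H \<equiv> digraph_iso (with_proj G) (with_proj H)"

lemma complete_bipartite_graph_library:
  "complete_bipartite_digraph a b (with_proj (complete_bipartite_graph a b))"
proof -
  let ?X = "Inl ` {..<a} :: (nat + nat) set" and ?Y = "Inr ` {..<b} :: (nat + nat) set"
  have "?X \<inter> ?Y = {}" "card ?X = a" "card ?Y = b"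
    by (auto simp: card_image)
  then show ?thesis
    unfolding complete_bipartite_digraph_pair_def complete_bipartite_graph_def Let_def
    by (intro conjI exI[of _ ?X] exI[of _ ?Y]) simp_all
qed

lemma pair_graph_double_nested_graph: "pair_graph (double_nested_graph p1 p2 q1 q2)"
proof -
  let ?G = "double_nested_graph p1 p2 q1 q2"
  let ?X = "Inl ` {..<p1 + p2} :: (nat + nat) set" and ?Y = "Inr ` {..<q1 + q2} :: (nat + nat) set"
  have V: "pverts ?G = ?X \<union> ?Y"
    by (auto simp: double_nested_graph_def Let_def image_iff not_less)
  have E: "parcs ?G \<subseteq> ?X \<times> ?Y \<union> ?Y \<times> ?X" and s: "sym (parcs ?G)"
    by (auto simp: double_nested_graph_def Let_def sym_Un_converse)
  have f: "finite (?X \<union> ?Y)" by simp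
  have "finite (parcs ?G)" by (rule finite_subset[OF E]) simp
  moreover have "fst e \<in> ?X \<union> ?Y \<and> snd e \<in> ?X \<union> ?Y \<and> fst e \<noteq> snd e" if "e \<in> parcs ?G" for e
    using E that by fastforce
  ultimately show ?thesis
    using V f s by unfold_locales (simp_all add: symmetric_def)
qed

lemma spectrum_adjacency_matrix:
  assumes d: "distinct vs" and V: "set vs = pverts G"
  shows "k \<in> spectrum (adjacency_matrix G vs) \<longleftrightarrow>
    (\<exists>x. (\<exists>v\<in>pverts G. x v \<noteq> 0) \<and>
         (\<forall>v\<in>pverts G. (\<Sum>u\<in>pverts G. if (v, u) \<in> parcs G then x u else 0) = k * x v))"
    (is "?L \<longleftrightarrow> (\<exists>x. ?P x)")
proof -
  let ?n = "length vs" and ?A = "adjacency_matrix G vs"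
  have bij: "bij_betw ((!) vs) {0..<?n} (pverts G)"
    using bij_betw_nth[OF d _ V[symmetric]] by (simp add: atLeast0LessThan)
  have entry: "(?A *\<^sub>v w) $ i = (\<Sum>u\<in>pverts G. if (vs ! i, u) \<in> parcs G then x u else 0)"
    if i: "i < ?n" and w: "dim_vec w = ?n" "\<And>j. j < ?n \<Longrightarrow> w $ j = x (vs ! j)" for w x i
  proof -
    have "(?A *\<^sub>v w) $ i = (\<Sum>j = 0..<?n. if (vs ! i, vs ! j) \<in> parcs G then x (vs ! j) else 0)"
      using i w by (auto simp: adjacency_matrix_def scalar_prod_def intro!: sum.cong)
    also have "\<dots> = (\<Sum>u\<in>pverts G. if (vs ! i, u) \<in> parcs G then x u else 0)"
      by (rule sum.reindex_bij_betw[OF bij])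
    finally show ?thesis .
  qed
  have dimA: "dim_row ?A = ?n" by (simp add: adjacency_matrix_def)
  have spec: "?L \<longleftrightarrow> (\<exists>w. dim_vec w = ?n \<and> w \<noteq> 0\<^sub>v ?n \<and> ?A *\<^sub>v w = k \<cdot>\<^sub>v w)"
    unfolding spectrum_def eigenvalue_def eigenvector_def mem_Collect_eq dimA carrier_vec_def ..
  have ex: "\<exists>i<?n. vs ! i = v" if "v \<in> pverts G" for v
    using that V by (auto simp: in_set_conv_nth)
  show ?thesis
  proof
    assume ?L
    then obtain w where w: "dim_vec w = ?n" "w \<noteq> 0\<^sub>v ?n" "?A *\<^sub>v w = k \<cdot>\<^sub>v w"
      unfolding spec by blast
    define x where "x v = w $ (THE i. i < ?n \<and> vs ! i = v)" for v
    have x: "w $ j = x (vs ! j)" if "j < ?n" for j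
    proof -
      have "(THE i. i < ?n \<and> vs ! i = vs ! j) = j"
        by (rule the_equality) (use that d nth_eq_iff_index_eq in blast)+
      then show ?thesis by (simp add: x_def)
    qed
    obtain j where "j < ?n" "w $ j \<noteq> 0"
    proof -
      have "\<exists>j<?n. w $ j \<noteq> 0"
      proof (rule ccontr)
        assume "\<not> ?thesis"
        then have "w = 0\<^sub>v ?n" using w(1) by (intro eq_vecI) auto
        with w(2) show False by contradiction
      qed
      then show ?thesis using that by blast
    qed
    then have "x (vs ! j) \<noteq> 0" "vs ! j \<in> pverts G" using x[of j] V nth_mem[of j vs] by auto
    then have "\<exists>v\<in>pverts G. x v \<noteq> 0" by blast
    moreover have "(\<Sum>u\<in>pverts G. if (v, u) \<in> parcs G then x u else 0) = k * x v"
      if v: "v \<in> pverts G" for v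
    proof -
      obtain i where i: "i < ?n" "vs ! i = v" using ex[OF v] by blast
      have "(?A *\<^sub>v w) $ i = k * w $ i" unfolding w(3) using w(1) i(1) by simp
      then show ?thesis using entry[OF i(1) w(1) x] x[OF i(1)] i by simp
    qed
    ultimately show "\<exists>x. ?P x" by blast
  next
    assume "\<exists>x. ?P x"
    then obtain x where x: "?P x" by blast
    define w where "w = vec ?n (\<lambda>j. x (vs ! j))"
    have w: "dim_vec w = ?n" "\<And>j. j < ?n \<Longrightarrow> w $ j = x (vs ! j)" by (auto simp: w_def)
    obtain i where "i < ?n" "x (vs ! i) \<noteq> 0"
    proof -
      obtain v where v: "v \<in> pverts G" "x v \<noteq> 0" using x by blast
      obtain i where "i < ?n" "vs ! i = v" using ex[OF v(1)] by blast
      then show ?thesis using v(2) that by blast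
    qed
    then have "w $ i \<noteq> 0\<^sub>v ?n $ i" by (simp add: w(2))
    then have "w \<noteq> 0\<^sub>v ?n" by blast
    moreover have "?A *\<^sub>v w = k \<cdot>\<^sub>v w"
    proof (rule eq_vecI)
      fix i assume "i < dim_vec (k \<cdot>\<^sub>v w)"
      then have i: "i < ?n" using w by simp
      then have "vs ! i \<in> pverts G" using V nth_mem by blast
      then show "(?A *\<^sub>v w) $ i = (k \<cdot>\<^sub>v w) $ i"
        using x entry[OF i w] w i by simp
    qed (simp add: dimA w(1))
    ultimately show ?L
      unfolding spec using w(1) by blast
  qed
qed

end

theory Submission
  imports Defs
begin

text \<open>
  A set \<open>S\<close> witnessing \<open>b(G) < 1/r\<close> can be taken inside one part and cut down to \<open>r t + 1\<close>
  vertices whose neighbours lie in a set of \<open>t\<close> vertices. Hence \<open>G\<close> is a spanning subgraph of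
  \<open>K\<^bsub>n-t,t\<^esub>\<close> or of \<open>D(p, r t + 1; t, q)\<close>, and an explicit positive eigenvector of the
  supergraph bounds \<open>\<rho>(G)\<close>, with equality only for the supergraph itself. Among the graphs
  \<open>K\<^bsub>n-t,t\<^esub>\<close> the largest admissible \<open>t\<close> is best. For \<open>D(p, r t + 1; t, q)\<close> with \<open>t \<ge> 2\<close>
  (or \<open>r = 1\<close>) the crude bound \<open>\<rho>\<^sup>2 < |E|\<close> suffices, because the largest \<open>|E|\<close> over \<open>p + q\<close> fixed is
  bounded by a convex function of \<open>t\<close>. For \<open>t = 1\<close> the equation of \<open>\<rho>\<^sup>2\<close> is a quadratic in \<open>p\<close>
  whose optimal integer point is \<open>p = \<lceil>(n - r - 1) / 2\<rceil>\<close>.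
\<close>

section \<open>Spectral radius and positive eigenvectors\<close>

text \<open>\<open>spectrum\<close> of a real matrix contains only real eigenvalues, so it could be
  empty for a general matrix, and the \<open>Max\<close> in \<open>graph_rho\<close> would then mean
  nothing. A complex eigenvalue always exists; symmetry makes it real.\<close>

lemma spectrum_symmetric_real_nonempty:
  fixes A :: "real mat"
  assumes A: "A \<in> carrier_mat n n" and n: "n > 0"
    and sym: "\<And>i j. i < n \<Longrightarrow> j < n \<Longrightarrow> A $$ (i, j) = A $$ (j, i)"
  shows "spectrum A \<noteq> {}"
proof -
  let ?B = "map_mat complex_of_real A"
  have B: "?B \<in> carrier_mat n n" using A by simp
  obtain k where k: "k \<in> spectrum ?B"
    using spectrum_non_empty[OF B n] by blast
  then obtain w where w: "w \<in> carrier_vec n" "w \<noteq> 0\<^sub>v n" "?B *\<^sub>v w = k \<cdot>\<^sub>v w"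
    using B by (auto simp: spectrum_def eigenvalue_def eigenvector_def)
  have row: "(\<Sum>j<n. complex_of_real (A $$ (i, j)) * w $ j) = k * w $ i" if i: "i < n" for i
  proof -
    have "(?B *\<^sub>v w) $ i = (\<Sum>j<n. complex_of_real (A $$ (i, j)) * w $ j)"
      using i A w(1) by (auto simp: scalar_prod_def atLeast0LessThan intro!: sum.cong)
    then show ?thesis using w i by simp
  qed
  \<comment> \<open>With \<open>w*\<close> the conjugate transpose, \<open>N\<close> is
    \<open>w* w\<close> and \<open>Q\<close> is \<open>w* A w\<close>. The eigenvalue equation gives
    \<open>Q = k N\<close>, and symmetry makes \<open>Q\<close> equal to its conjugate, hence
    \<open>k\<close> real.\<close>
  define N where "N = (\<Sum>i<n. (cmod (w $ i))\<^sup>2)"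
  define Q where "Q = (\<Sum>i<n. \<Sum>j<n. complex_of_real (A $$ (i, j)) * (cnj (w $ i) * w $ j))"
  obtain i0 where i0: "i0 < n" "w $ i0 \<noteq> 0"
    using w(1,2) by (metis carrier_vecD dim_vec eq_vecI index_zero_vec(1,2))
  have "0 < (cmod (w $ i0))\<^sup>2" using i0 by simp
  also have "\<dots> \<le> N" unfolding N_def
    by (rule member_le_sum) (use i0 in auto)
  finally have N: "N > 0" .
  have QN: "Q = k * of_real N"
  proof -
    have "Q = (\<Sum>i<n. cnj (w $ i) * (\<Sum>j<n. complex_of_real (A $$ (i, j)) * w $ j))"
      unfolding Q_def by (simp add: sum_distrib_left algebra_simps)
    also have "\<dots> = (\<Sum>i<n. k * of_real ((cmod (w $ i))\<^sup>2))"
    proof (intro sum.cong refl)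
      fix i assume "i \<in> {..<n}"
      then have "cnj (w $ i) * (\<Sum>j<n. complex_of_real (A $$ (i, j)) * w $ j) = k * (w $ i * cnj (w $ i))"
        by (simp add: row)
      then show "cnj (w $ i) * (\<Sum>j<n. complex_of_real (A $$ (i, j)) * w $ j) = k * of_real ((cmod (w $ i))\<^sup>2)"
        by (simp only: complex_norm_square)
    qed
    finally show ?thesis by (simp add: N_def sum_distrib_left)
  qed
  have "cnj Q = (\<Sum>i<n. \<Sum>j<n. complex_of_real (A $$ (i, j)) * (w $ i * cnj (w $ j)))"
    unfolding Q_def by simp
  also have "\<dots> = (\<Sum>j<n. \<Sum>i<n. complex_of_real (A $$ (i, j)) * (w $ i * cnj (w $ j)))"
    by (rule sum.swap)
  also have "\<dots> = Q" unfolding Q_def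
    by (intro sum.cong refl) (auto simp: sym mult.commute)
  finally have "cnj Q = Q" .
  then have "cnj k = k" using N by (simp add: QN)
  then obtain \<kappa> where \<kappa>: "k = of_real \<kappa>"
    by (metis Reals_cnj_iff Reals_cases)
  \<comment> \<open>The vector \<open>w\<close> may still be complex, so the return to the real
    matrix goes through the characteristic polynomial.\<close>
  have "poly (char_poly ?B) k = 0"
    using k spectrum_root_char_poly[OF B] by simp
  then have "complex_of_real (poly (char_poly A) \<kappa>) = 0"
    by (simp add: \<kappa> of_real_hom.char_poly_hom[OF A] of_real_hom.poly_map_poly)
  then show ?thesis
    using spectrum_root_char_poly[OF A] by auto
qed

text \<open>An eigenvector as a function on the vertices, in the form given by
  \<open>spectrum_adjacency_matrix\<close>, so that no enumeration of the vertices is carried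
  along.\<close>

definition graph_eigen :: "'a pair_pre_digraph \<Rightarrow> real \<Rightarrow> ('a \<Rightarrow> real) \<Rightarrow> bool" where
  "graph_eigen G k x \<longleftrightarrow> (\<exists>v\<in>pverts G. x v \<noteq> 0) \<and>
     (\<forall>v\<in>pverts G. (\<Sum>u\<in>pverts G. if (v, u) \<in> parcs G then x u else 0) = k * x v)"

text \<open>The interface to \<open>graph_rho\<close>: it is attained as an eigenvalue and it
  dominates every eigenvalue. The choice of an enumeration and the \<open>Max\<close> are unfolded
  only here.\<close>

lemma
  assumes G: "pair_graph G" and ne: "pverts G \<noteq> {}"
  shows graph_rho_eigen: "\<exists>x. graph_eigen G (graph_rho G) x"
    and graph_rho_ge: "graph_eigen G k x \<Longrightarrow> k \<le> graph_rho G"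
proof -
  interpret pair_graph G by (rule G)
  define vs where "vs = (SOME vs. distinct vs \<and> set vs = pverts G)"
  have "\<exists>vs. distinct vs \<and> set vs = pverts G"
    using finite_distinct_list[OF pair_finite_verts] by blast
  from someI_ex[OF this] have vs: "distinct vs" "set vs = pverts G"
    unfolding vs_def by auto
  let ?A = "adjacency_matrix G vs"
  have A: "?A \<in> carrier_mat (length vs) (length vs)" by (simp add: adjacency_matrix_def)
  have s: "(u, v) \<in> parcs G \<longleftrightarrow> (v, u) \<in> parcs G" for u v
    using pair_sym_arcs by (auto simp: symmetric_def sym_def)
  have "spectrum ?A \<noteq> {}"
    by (rule spectrum_symmetric_real_nonempty[OF A])
      (use vs ne s in \<open>auto simp: adjacency_matrix_def\<close>)
  then have "Max (spectrum ?A) \<in> spectrum ?A"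
    using card_finite_spectrum(1)[OF A] by (rule Max_in[rotated])
  then show "\<exists>x. graph_eigen G (graph_rho G) x"
    unfolding graph_rho_def graph_eigen_def vs_def[symmetric]
    using spectrum_adjacency_matrix[OF vs] by blast
  assume "graph_eigen G k x"
  then have "k \<in> spectrum ?A"
    unfolding graph_eigen_def using spectrum_adjacency_matrix[OF vs] by blast
  then show "k \<le> graph_rho G"
    unfolding graph_rho_def vs_def[symmetric]
    using card_finite_spectrum(1)[OF A] by (rule Max_ge[rotated])
qed

text \<open>
  Pairing \<open>\<bar>x\<bar>\<close>, for an eigenvector \<open>x\<close> of \<open>G\<close>, with a positive eigenvector \<open>z\<close> of a
  supergraph \<open>H\<close> bounds the eigenvalues of \<open>G\<close> by that of \<open>z\<close>; in the case of equality \<open>\<bar>x\<bar>\<close> is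
  an eigenvector of \<open>H\<close> as well, and it has no zero because \<open>H\<close> is connected.
\<close>

lemma
  assumes G: "pair_graph G" and ne: "pverts G \<noteq> {}"
    and GH: "parcs G \<subseteq> H" and HV: "H \<subseteq> pverts G \<times> pverts G" and symH: "sym H"
    and z: "\<And>v. v \<in> pverts G \<Longrightarrow> z v > 0"
    and Hz: "\<And>v. v \<in> pverts G \<Longrightarrow> (\<Sum>u\<in>pverts G. if (v, u) \<in> H then z u else 0) = \<rho> * z v"
  shows graph_rho_le_supergraph: "graph_rho G \<le> \<rho>"
    and graph_rho_eq_supergraph:
      "graph_rho G = \<rho> \<Longrightarrow>
        (\<And>S v. S \<subseteq> pverts G \<Longrightarrow> v \<in> S \<Longrightarrow> (\<And>a b. a \<in> S \<Longrightarrow> (a, b) \<in> H \<Longrightarrow> b \<in> S) \<Longrightarrow> S = pverts G) \<Longrightarrow>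
        parcs G = H"
    and graph_rho_positive_eigenvector: "parcs G = H \<Longrightarrow> graph_rho G = \<rho>"
proof -
  interpret pair_graph G by (rule G)
  let ?V = "pverts G"
  have fin[simp]: "finite ?V" by (rule pair_finite_verts)
  obtain x where "graph_eigen G (graph_rho G) x"
    using graph_rho_eigen[OF G ne] by blast
  then have x0: "\<exists>v\<in>?V. x v \<noteq> 0"
    and x: "\<And>v. v \<in> ?V \<Longrightarrow> (\<Sum>u\<in>?V. if (v, u) \<in> parcs G then x u else 0) = graph_rho G * x v"
    unfolding graph_eigen_def by auto
  define k where "k = graph_rho G"
  define y where "y v = \<bar>x v\<bar>" for v
  have y0: "y v \<ge> 0" for v by (simp add: y_def)
  define AG where "AG v = (\<Sum>u\<in>?V. if (v, u) \<in> parcs G then y u else 0)" for v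
  define AH where "AH v = (\<Sum>u\<in>?V. if (v, u) \<in> H then y u else 0)" for v
  have le1: "k * y v \<le> AG v" if "v \<in> ?V" for v
  proof -
    have "k * y v \<le> \<bar>k * x v\<bar>" by (simp add: y_def abs_mult mult_right_mono)
    also have "\<dots> \<le> (\<Sum>u\<in>?V. \<bar>if (v, u) \<in> parcs G then x u else 0\<bar>)"
      unfolding k_def x[OF that, symmetric] by (rule sum_abs)
    also have "\<dots> = AG v" unfolding AG_def by (intro sum.cong) (auto simp: y_def)
    finally show ?thesis .
  qed
  have le2: "AG v \<le> AH v" for v
    unfolding AG_def AH_def by (rule sum_mono) (use GH y0 in auto)
  \<comment> \<open>Symmetry of \<open>H\<close> moves it from \<open>y\<close> to \<open>z\<close>,
    where it acts as multiplication by \<open>\<rho>\<close>.\<close>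
  have pair: "(\<Sum>v\<in>?V. AH v * z v) = \<rho> * (\<Sum>v\<in>?V. y v * z v)"
  proof -
    have "(\<Sum>v\<in>?V. AH v * z v) = (\<Sum>v\<in>?V. \<Sum>u\<in>?V. if (v, u) \<in> H then y u * z v else 0)"
      unfolding AH_def sum_distrib_right by (intro sum.cong) auto
    also have "\<dots> = (\<Sum>u\<in>?V. \<Sum>v\<in>?V. if (v, u) \<in> H then y u * z v else 0)"
      by (rule sum.swap)
    also have "\<dots> = (\<Sum>u\<in>?V. y u * (\<Sum>v\<in>?V. if (u, v) \<in> H then z v else 0))"
      unfolding sum_distrib_left using symH by (intro sum.cong) (auto simp: sym_def)
    also have "\<dots> = (\<Sum>u\<in>?V. y u * (\<rho> * z u))" by (simp add: Hz)
    finally show ?thesis by (simp add: sum_distrib_left algebra_simps)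
  qed
  obtain v0 where v0: "v0 \<in> ?V" "x v0 \<noteq> 0" using x0 by blast
  have "0 < y v0 * z v0" using v0 z by (simp add: y_def)
  also have "\<dots> \<le> (\<Sum>v\<in>?V. y v * z v)"
    by (rule member_le_sum) (use v0 z y0 in \<open>auto simp: less_imp_le\<close>)
  finally have pos: "(\<Sum>v\<in>?V. y v * z v) > 0" .
  have "k * (\<Sum>v\<in>?V. y v * z v) = (\<Sum>v\<in>?V. k * y v * z v)"
    by (simp add: sum_distrib_left algebra_simps)
  also have "\<dots> \<le> (\<Sum>v\<in>?V. AH v * z v)"
    by (intro sum_mono mult_right_mono) (use le1 le2 z in \<open>auto simp: less_imp_le intro: order_trans\<close>)
  finally show le: "graph_rho G \<le> \<rho>" using pos by (simp add: pair k_def)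
  show "graph_rho G = \<rho>" if "parcs G = H"
  proof (rule antisym[OF le])
    have "z v0 \<noteq> 0" using z[OF v0(1)] by simp
    then show "\<rho> \<le> graph_rho G"
      by (intro graph_rho_ge[OF G ne, of _ z]) (use Hz v0 that in \<open>auto simp: graph_eigen_def\<close>)
  qed
  assume eq: "graph_rho G = \<rho>"
    and conn: "\<And>S v. S \<subseteq> ?V \<Longrightarrow> v \<in> S \<Longrightarrow> (\<And>a b. a \<in> S \<Longrightarrow> (a, b) \<in> H \<Longrightarrow> b \<in> S) \<Longrightarrow> S = ?V"
  \<comment> \<open>In the case of equality a sum of nonnegative terms vanishes. As every
    \<open>z v\<close> is positive, \<open>y\<close> satisfies the eigenvalue equation of
    \<open>H\<close> at each vertex.\<close>
  have "(\<Sum>v\<in>?V. (AH v - k * y v) * z v) = 0"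
    using pair eq by (simp add: left_diff_distrib sum_subtractf sum_distrib_left k_def algebra_simps)
  moreover have "0 \<le> (AH v - k * y v) * z v" if "v \<in> ?V" for v
    using le1[OF that] le2[of v] z[OF that] by (intro mult_nonneg_nonneg) auto
  ultimately have "(AH v - k * y v) * z v = 0" if "v \<in> ?V" for v
    using that by (simp add: sum_nonneg_eq_0_iff)
  then have AHy: "AH v = k * y v" if "v \<in> ?V" for v using z[OF that] that by fastforce
  have AGH: "AG v = AH v" if "v \<in> ?V" for v
    using AHy[OF that] le1[OF that] le2[of v] by simp
  \<comment> \<open>A zero of \<open>y\<close> forces zeros at all its \<open>H\<close>-neighbours,
    so the zero set is closed under \<open>H\<close>. If nonempty it would be everything, against
    \<open>y v0 > 0\<close>.\<close>
  have "{v \<in> ?V. y v = 0} = ?V" if "v \<in> ?V" "y v = 0" for v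
  proof (rule conn)
    show "v \<in> {v \<in> ?V. y v = 0}" using that by simp
    fix a b assume a: "a \<in> {v \<in> ?V. y v = 0}" and ab: "(a, b) \<in> H"
    then have b: "b \<in> ?V" using HV by auto
    have "AH a = 0" using AHy a by simp
    then have "(if (a, b) \<in> H then y b else 0) = 0"
      unfolding AH_def using b y0 by (subst (asm) sum_nonneg_eq_0_iff) auto
    then show "b \<in> {v \<in> ?V. y v = 0}" using b ab by simp
  qed auto
  then have ypos: "y v > 0" if "v \<in> ?V" for v
    using that v0 y0[of v] by (auto simp: y_def)
  show "parcs G = H"
  proof (rule antisym[OF GH], rule subsetI)
    \<comment> \<open>An arc of \<open>H\<close> missing from \<open>G\<close> would make
      \<open>AG a\<close> strictly smaller than \<open>AH a\<close>, because \<open>y\<close> is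
      positive everywhere.\<close>
    fix e assume e: "e \<in> H"
    obtain a b where ab: "e = (a, b)" by (cases e)
    have V: "a \<in> ?V" "b \<in> ?V" using e ab HV by auto
    have "(\<Sum>u\<in>?V. (if (a, u) \<in> H then y u else 0) - (if (a, u) \<in> parcs G then y u else 0)) = 0"
      using AGH[OF V(1)] unfolding AG_def AH_def sum_subtractf by simp
    then have "(if (a, b) \<in> H then y b else 0) - (if (a, b) \<in> parcs G then y b else 0) = 0"
      using V GH y0 by (subst (asm) sum_nonneg_eq_0_iff) auto
    then show "e \<in> parcs G" using e ab ypos[OF V(2)] by (auto split: if_splits)
  qed
qed

section \<open>Isomorphism invariance and the template graphs\<close>

text \<open>A library isomorphism carries its own arc map and its own head and tail maps. Since
  \<open>with_proj\<close> fixes head and tail as projections on both sides, the arc map is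
  determined by the vertex map, which alone is kept.\<close>

lemma graph_isoD:
  assumes "graph_iso G H"
  obtains f where "bij_betw f (pverts G) (pverts H)"
    and "\<And>u v. u \<in> pverts G \<Longrightarrow> v \<in> pverts G \<Longrightarrow> (u, v) \<in> parcs G \<longleftrightarrow> (f u, f v) \<in> parcs H"
proof -
  obtain h where h: "pre_digraph.digraph_isomorphism (with_proj G) h"
    and H: "with_proj H = app_iso h (with_proj G)"
    using assms unfolding digraph_iso_def by blast
  let ?f = "iso_verts h"
  have V: "pverts H = ?f ` pverts G"
    using arg_cong[OF H, of verts] by simp
  have E: "parcs H = iso_arcs h ` parcs G"
    using arg_cong[OF H, of arcs] by simp
  have th: "iso_tail h = fst" "iso_head h = snd"
    using arg_cong[OF H, of tail] arg_cong[OF H, of head] by simp_all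
  have inj: "inj_on ?f (pverts G)" and wf: "wf_digraph (with_proj G)"
    and arcs: "\<And>a. a \<in> parcs G \<Longrightarrow> ?f (fst a) = fst (iso_arcs h a) \<and> ?f (snd a) = snd (iso_arcs h a)"
    using h th unfolding pre_digraph.digraph_isomorphism_def by auto
  have arc: "iso_arcs h a = (?f (fst a), ?f (snd a))" if "a \<in> parcs G" for a
    using arcs[OF that] by (metis prod.collapse)
  show thesis
  proof (rule that)
    show "bij_betw ?f (pverts G) (pverts H)" using inj V by (simp add: bij_betw_def)
    fix u v assume uv: "u \<in> pverts G" "v \<in> pverts G"
    show "(u, v) \<in> parcs G \<longleftrightarrow> (?f u, ?f v) \<in> parcs H"
    proof
      assume "(u, v) \<in> parcs G"
      from imageI[OF this, of "iso_arcs h"] arc[OF this] show "(?f u, ?f v) \<in> parcs H"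
        by (simp add: E)
    next
      assume "(?f u, ?f v) \<in> parcs H"
      then obtain a where a: "a \<in> parcs G" "(?f u, ?f v) = iso_arcs h a" by (auto simp: E)
      have "fst a \<in> pverts G" "snd a \<in> pverts G"
        using wf_digraph.tail_in_verts[OF wf, of a] wf_digraph.head_in_verts[OF wf, of a] a(1) by simp_all
      then have "fst a = u" "snd a = v"
        using inj uv a arc[OF a(1)] by (auto dest: inj_onD)
      then show "(u, v) \<in> parcs G" using a(1) by (cases a) simp
    qed
  qed
qed

lemma graph_isoI:
  assumes G: "pair_graph G" and H: "pair_graph H"
    and f: "bij_betw f (pverts G) (pverts H)"
    and e: "\<And>u v. u \<in> pverts G \<Longrightarrow> v \<in> pverts G \<Longrightarrow> (u, v) \<in> parcs G \<longleftrightarrow> (f u, f v) \<in> parcs H"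
  shows "graph_iso G H"
proof -
  interpret G: pair_graph G by (rule G)
  interpret H: pair_graph H by (rule H)
  define h where "h = \<lparr>iso_verts = f, iso_arcs = map_prod f f, iso_head = snd, iso_tail = fst\<rparr>"
  have inj: "inj_on f (pverts G)" and im: "f ` pverts G = pverts H"
    using f by (auto simp: bij_betw_def)
  have sub: "parcs G \<subseteq> pverts G \<times> pverts G"
    by (auto dest: G.in_arcsD1 G.in_arcsD2)
  have "inj_on (map_prod f f) (parcs G)"
    by (rule inj_on_subset[OF map_prod_inj_on[OF inj inj] sub])
  then have "pre_digraph.digraph_isomorphism (with_proj G) h"
    unfolding pre_digraph.digraph_isomorphism_def
    using inj G.wf_digraph_axioms by (simp add: h_def)
  moreover have "map_prod f f ` parcs G = parcs H"
  proof (intro equalityI subsetI)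
    fix x assume "x \<in> map_prod f f ` parcs G"
    then show "x \<in> parcs H" using e sub by auto
  next
    fix x assume x: "x \<in> parcs H"
    obtain a b where ab: "x = (a, b)" by (cases x)
    have "a \<in> pverts H" "b \<in> pverts H" using x ab H.in_arcsD1 H.in_arcsD2 by auto
    then obtain u v where uv: "u \<in> pverts G" "v \<in> pverts G" "a = f u" "b = f v"
      unfolding im[symmetric] by blast
    then have "(u, v) \<in> parcs G" using e x ab by simp
    from imageI[OF this, of "map_prod f f"] show "x \<in> map_prod f f ` parcs G"
      using uv ab by simp
  qed
  ultimately show ?thesis
    unfolding digraph_iso_def
    by (intro exI[of _ h]) (simp add: app_iso_def h_def with_proj_def im)
qed

lemma graph_eigen_bij_betw:
  assumes f: "bij_betw f (pverts G) (pverts H)"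
    and e: "\<And>u v. u \<in> pverts G \<Longrightarrow> v \<in> pverts G \<Longrightarrow> (u, v) \<in> parcs G \<longleftrightarrow> (f u, f v) \<in> parcs H"
    and x: "graph_eigen H k x"
  shows "graph_eigen G k (x \<circ> f)"
proof -
  have im: "f ` pverts G = pverts H" using f by (auto simp: bij_betw_def)
  have "(\<Sum>u\<in>pverts G. if (v, u) \<in> parcs G then (x \<circ> f) u else 0) = k * (x \<circ> f) v"
    if v: "v \<in> pverts G" for v
  proof -
    have "(\<Sum>u\<in>pverts G. if (v, u) \<in> parcs G then (x \<circ> f) u else 0)
        = (\<Sum>u\<in>pverts G. if (f v, f u) \<in> parcs H then x (f u) else 0)"
      using e v by (intro sum.cong) auto
    also have "\<dots> = (\<Sum>w\<in>pverts H. if (f v, w) \<in> parcs H then x w else 0)"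
      by (rule sum.reindex_bij_betw[OF f])
    finally show ?thesis using x v im by (auto simp: graph_eigen_def)
  qed
  moreover have "\<exists>v\<in>pverts G. (x \<circ> f) v \<noteq> 0"
    using x unfolding graph_eigen_def im[symmetric] by auto
  ultimately show ?thesis by (simp add: graph_eigen_def)
qed

text \<open>Eigenvectors are pulled back along the bijection and along its inverse; each direction
  gives one inequality.\<close>

lemma graph_rho_iso:
  assumes G: "pair_graph G" and H: "pair_graph H" and ne: "pverts G \<noteq> {}"
    and iso: "graph_iso G H"
  shows "graph_rho G = graph_rho H"
proof -
  obtain f where f: "bij_betw f (pverts G) (pverts H)"
    and e: "\<And>u v. u \<in> pverts G \<Longrightarrow> v \<in> pverts G \<Longrightarrow> (u, v) \<in> parcs G \<longleftrightarrow> (f u, f v) \<in> parcs H"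
    using graph_isoD[OF iso] by blast
  let ?g = "inv_into (pverts G) f"
  have neH: "pverts H \<noteq> {}" using f ne by (auto simp: bij_betw_def)
  have g: "bij_betw ?g (pverts H) (pverts G)" by (rule bij_betw_inv_into[OF f])
  have fg: "f (?g w) = w" "?g w \<in> pverts G" if "w \<in> pverts H" for w
    using that f g by (auto simp: bij_betw_def f_inv_into_f)
  have eg: "(u, v) \<in> parcs H \<longleftrightarrow> (?g u, ?g v) \<in> parcs G" if "u \<in> pverts H" "v \<in> pverts H" for u v
    using e[of "?g u" "?g v"] fg that by simp
  obtain x where "graph_eigen G (graph_rho G) x" using graph_rho_eigen[OF G ne] by blast
  from graph_rho_ge[OF H neH graph_eigen_bij_betw[OF g eg this]]
  have "graph_rho G \<le> graph_rho H" by simp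
  moreover
  obtain x where "graph_eigen H (graph_rho H) x" using graph_rho_eigen[OF H neH] by blast
  from graph_rho_ge[OF G ne graph_eigen_bij_betw[OF f e this]]
  have "graph_rho H \<le> graph_rho G" by simp
  ultimately show ?thesis by simp
qed

text \<open>
  The squared spectral radius of \<open>D(p\<^sub>1,p\<^sub>2;q\<^sub>1,q\<^sub>2)\<close> is the larger root of
  \<open>x\<^sup>2 - e x + p\<^sub>1 p\<^sub>2 q\<^sub>1 q\<^sub>2\<close>, where \<open>e\<close> is the number of edges.
\<close>

definition nested_root :: "real \<Rightarrow> real \<Rightarrow> real \<Rightarrow> real \<Rightarrow> real" where
  "nested_root p1 p2 q1 q2 =
     (let e = p1 * q1 + p1 * q2 + p2 * q1 in (e + sqrt (e\<^sup>2 - 4 * (p1 * p2 * q1 * q2))) / 2)"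

text \<open>The quadratic is negative only between its roots, so any point with a negative value
  lies below the larger root \<open>L\<close>. The lower bounds evaluate it at the squared radii of
  the subgraphs \<open>K\<close> with parts \<open>p1, q1 + q2\<close> and \<open>p2, q1\<close>.
  The upper bound holds because \<open>L * (e - L)\<close> is the positive constant term.\<close>

lemma
  fixes p1 p2 q1 q2 :: real
  assumes pos: "p1 > 0" "p2 > 0" "q1 > 0" "q2 > 0"
  defines "e \<equiv> p1 * q1 + p1 * q2 + p2 * q1" and "L \<equiv> nested_root p1 p2 q1 q2"
  shows nested_root_eq: "L * L - e * L + p1 * p2 * q1 * q2 = 0"
    and nested_root_gt: "x * x - e * x + p1 * p2 * q1 * q2 < 0 \<Longrightarrow> x < L"
    and nested_root_gt_left: "p1 * (q1 + q2) < L"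
    and nested_root_gt_right: "p2 * q1 < L"
    and nested_root_less_edges: "L < e"
proof -
  let ?c = "p1 * p2 * q1 * q2"
  define d where "d = sqrt (e\<^sup>2 - 4 * ?c)"
  have c: "?c > 0" using pos by simp
  have e: "e > 0" using pos by (simp add: e_def add_pos_pos)
  \<comment> \<open>The discriminant as a square plus a positive term: the roots are real and
    distinct.\<close>
  have "e\<^sup>2 - 4 * ?c = (p1 * q1 + p1 * q2 - p2 * q1)\<^sup>2 + 4 * (p1 * q1 * (p2 * q1))"
    by (simp add: e_def power2_eq_square algebra_simps)
  moreover have "4 * (p1 * q1 * (p2 * q1)) > 0" using pos by simp
  ultimately have "e\<^sup>2 - 4 * ?c > 0"
    by (metis add_nonneg_pos zero_le_power2)
  then have d: "d * d = e * e - 4 * ?c" "d > 0"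
    by (simp_all add: d_def power2_eq_square)
  have L: "L = (e + d) / 2"
    by (simp add: L_def nested_root_def Let_def e_def d_def)
  show root: "L * L - e * L + ?c = 0"
    using d(1) by (simp add: L field_simps)
  show gt: "x < L" if x: "x * x - e * x + ?c < 0" for x
  proof (rule ccontr)
    assume "\<not> x < L"
    then have "0 \<le> (x - L) * (x - (e - d) / 2)"
      by (intro mult_nonneg_nonneg) (use L d(2) in \<open>auto simp: field_simps\<close>)
    also have "\<dots> = x * x - e * x + ?c"
      using d(1) by (simp add: L field_simps)
    finally show False using x by simp
  qed
  have "p2 * q1 * (p1 * (q1 + q2)) > p1 * p2 * q1 * q2"
    using pos by (simp add: algebra_simps)
  then show "p1 * (q1 + q2) < L"
    by (intro gt) (simp add: e_def algebra_simps)
  have "p2 * q1 * (p1 * q1) > 0" using pos by simp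
  then show "p2 * q1 < L"
    by (intro gt) (simp add: e_def algebra_simps)
  have "L > 0" using e d(2) by (simp add: L)
  moreover have "L * (e - L) > 0" using root c by (simp add: algebra_simps)
  ultimately show "L < e" by (simp add: zero_less_mult_iff)
qed

text \<open>Stated for arbitrary vertex sets, so that it covers both a partition found inside
  \<open>G\<close> and the concrete templates. With \<open>X2\<close> and \<open>Y2\<close> empty it
  is the arc set of a complete bipartite graph.\<close>

definition nested_arcs :: "'a set \<Rightarrow> 'a set \<Rightarrow> 'a set \<Rightarrow> 'a set \<Rightarrow> 'a rel" where
  "nested_arcs X1 X2 Y1 Y2 =
     X1 \<times> (Y1 \<union> Y2) \<union> X2 \<times> Y1 \<union> ((Y1 \<union> Y2) \<times> X1 \<union> Y1 \<times> X2)"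

text \<open>The double nested supergraph has a positive eigenvector for \<open>sqrt L\<close> that
  is constant on each of the four classes, so the supergraph bounds apply.\<close>

lemma
  assumes G: "pair_graph G" and V: "pverts G = X1 \<union> X2 \<union> Y1 \<union> Y2"
    and disj: "X1 \<inter> X2 = {}" "Y1 \<inter> Y2 = {}" "(X1 \<union> X2) \<inter> (Y1 \<union> Y2) = {}"
    and ne: "X1 \<noteq> {}" "X2 \<noteq> {}" "Y1 \<noteq> {}" "Y2 \<noteq> {}"
    and E: "parcs G \<subseteq> nested_arcs X1 X2 Y1 Y2"
  defines "L \<equiv> nested_root (real (card X1)) (real (card X2)) (real (card Y1)) (real (card Y2))"
  shows graph_rho_le_nested: "graph_rho G \<le> sqrt L"
    and graph_rho_eq_nested: "graph_rho G = sqrt L \<longleftrightarrow> parcs G = nested_arcs X1 X2 Y1 Y2"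
proof -
  interpret pair_graph G by (rule G)
  let ?H = "nested_arcs X1 X2 Y1 Y2"
  define p1 p2 q1 q2 where pq: "p1 = real (card X1)" "p2 = real (card X2)"
    "q1 = real (card Y1)" "q2 = real (card Y2)"
  have fin: "finite X1" "finite X2" "finite Y1" "finite Y2"
    using pair_finite_verts V by auto
  have pos: "p1 > 0" "p2 > 0" "q1 > 0" "q2 > 0"
    using fin ne by (auto simp: pq card_gt_0_iff)
  have L: "L = nested_root p1 p2 q1 q2" by (simp add: L_def pq)
  note root = nested_root_eq[OF pos, folded L] and gt = nested_root_gt_right[OF pos, folded L]
  have Lpos: "L > 0" using gt pos by (smt (verit) mult_pos_pos)
  define \<rho> where "\<rho> = sqrt L"
  have \<rho>: "\<rho> > 0" "\<rho> * \<rho> = L" using Lpos by (simp_all add: \<rho>_def)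
  \<comment> \<open>After the normalization \<open>x2 = p1 * q1\<close>, the rows of
    \<open>X2\<close>, \<open>Y1\<close> and \<open>Y2\<close> force the other three weights in
    turn. The row of \<open>X1\<close> is then the quadratic equation of \<open>L\<close>, and
    \<open>p2 * q1 < L\<close> makes the weights positive.\<close>
  define x1 x2 y1 y2 where xy: "x1 = L - p2 * q1" "x2 = p1 * q1" "y1 = p1 * \<rho>"
    "y2 = p1 * (L - p2 * q1) / \<rho>"
  have xypos: "x1 > 0" "x2 > 0" "y1 > 0" "y2 > 0"
    using gt pos \<rho> by (simp_all add: xy)
  have eqs: "q1 * y1 + q2 * y2 = \<rho> * x1" "q1 * y1 = \<rho> * x2" "p1 * x1 + p2 * x2 = \<rho> * y1"
    "p1 * x1 = \<rho> * y2"
  proof -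
    have "\<rho> * (q1 * y1 + q2 * y2) = q1 * p1 * L + q2 * (p1 * (L - p2 * q1))"
      using \<rho> by (simp add: xy field_simps)
    also have "\<dots> = L * x1" using root by (simp add: xy algebra_simps)
    also have "\<dots> = \<rho> * (\<rho> * x1)" using \<rho>(2) by (metis mult.assoc)
    finally show "q1 * y1 + q2 * y2 = \<rho> * x1" using \<rho>(1) by simp
    show "q1 * y1 = \<rho> * x2" by (simp add: xy)
    have "p1 * x1 + p2 * x2 = p1 * L" by (simp add: xy algebra_simps)
    then show "p1 * x1 + p2 * x2 = \<rho> * y1" using \<rho>(2) by (simp add: xy algebra_simps)
    show "p1 * x1 = \<rho> * y2" using \<rho>(1) by (simp add: xy)
  qed
  define z where "z v = (if v \<in> X1 then x1 else if v \<in> X2 then x2 else if v \<in> Y1 then y1 else y2)" for v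
  have zv: "v \<in> X1 \<Longrightarrow> z v = x1" "v \<in> X2 \<Longrightarrow> z v = x2" "v \<in> Y1 \<Longrightarrow> z v = y1" "v \<in> Y2 \<Longrightarrow> z v = y2" for v
    using disj by (auto simp: z_def)
  have zpos: "z v > 0" for v using xypos by (simp add: z_def)
  have split: "(\<Sum>u\<in>pverts G. if (v, u) \<in> ?H then z u else 0) =
      (\<Sum>u\<in>X1. if (v, u) \<in> ?H then z u else 0) + (\<Sum>u\<in>X2. if (v, u) \<in> ?H then z u else 0) +
      (\<Sum>u\<in>Y1. if (v, u) \<in> ?H then z u else 0) + (\<Sum>u\<in>Y2. if (v, u) \<in> ?H then z u else 0)" for v
    unfolding V using fin disj by (subst sum.union_disjoint, auto)+
  have block: "(\<Sum>u\<in>B. if (v, u) \<in> ?H then z u else 0) = (if P then real (card B) * c else 0)"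
    if "\<And>u. u \<in> B \<Longrightarrow> ((v, u) \<in> ?H \<longleftrightarrow> P) \<and> z u = c" for B v P c
  proof -
    have "(\<Sum>u\<in>B. if (v, u) \<in> ?H then z u else 0) = (\<Sum>u\<in>B. if P then c else 0)"
      using that by (intro sum.cong) auto
    then show ?thesis by simp
  qed
  have Hz: "(\<Sum>u\<in>pverts G. if (v, u) \<in> ?H then z u else 0) = \<rho> * z v" if v: "v \<in> pverts G" for v
  proof -
    have b1: "(\<Sum>u\<in>X1. if (v, u) \<in> ?H then z u else 0) = (if v \<in> Y1 \<union> Y2 then p1 * x1 else 0)"
      unfolding pq by (rule block) (use disj zv in \<open>auto simp: nested_arcs_def\<close>)
    have b2: "(\<Sum>u\<in>X2. if (v, u) \<in> ?H then z u else 0) = (if v \<in> Y1 then p2 * x2 else 0)"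
      unfolding pq by (rule block) (use disj zv in \<open>auto simp: nested_arcs_def\<close>)
    have b3: "(\<Sum>u\<in>Y1. if (v, u) \<in> ?H then z u else 0) = (if v \<in> X1 \<union> X2 then q1 * y1 else 0)"
      unfolding pq by (rule block) (use disj zv in \<open>auto simp: nested_arcs_def\<close>)
    have b4: "(\<Sum>u\<in>Y2. if (v, u) \<in> ?H then z u else 0) = (if v \<in> X1 then q2 * y2 else 0)"
      unfolding pq by (rule block) (use disj zv in \<open>auto simp: nested_arcs_def\<close>)
    consider "v \<in> X1" | "v \<in> X2" | "v \<in> Y1" | "v \<in> Y2" using v V by auto
    then show ?thesis
    proof cases
      case 1 then show ?thesis unfolding split b1 b2 b3 b4 using disj eqs zv by auto
    next
      case 2 then show ?thesis unfolding split b1 b2 b3 b4 using disj eqs zv by auto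
    next
      case 3 then show ?thesis unfolding split b1 b2 b3 b4 using disj eqs zv by auto
    next
      case 4 then show ?thesis unfolding split b1 b2 b3 b4 using disj eqs zv by auto
    qed
  qed
  have neV: "pverts G \<noteq> {}" using V ne by auto
  have HV: "?H \<subseteq> pverts G \<times> pverts G" by (auto simp: V nested_arcs_def)
  have symH: "sym ?H" by (auto simp: sym_def nested_arcs_def)
  have conn: "S = pverts G" if S: "S \<subseteq> pverts G" "v \<in> S"
    and cl: "\<And>a b. a \<in> S \<Longrightarrow> (a, b) \<in> ?H \<Longrightarrow> b \<in> S" for S v
  proof -
    have X1: "Y1 \<union> Y2 \<subseteq> S" if "a \<in> S" "a \<in> X1" for a
      using cl[OF that(1)] that(2) by (auto simp: nested_arcs_def)
    have X2: "Y1 \<subseteq> S" if "a \<in> S" "a \<in> X2" for a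
      using cl[OF that(1)] that(2) by (auto simp: nested_arcs_def)
    have Y1: "X1 \<union> X2 \<subseteq> S" if "a \<in> S" "a \<in> Y1" for a
      using cl[OF that(1)] that(2) by (auto simp: nested_arcs_def)
    have Y2: "X1 \<subseteq> S" if "a \<in> S" "a \<in> Y2" for a
      using cl[OF that(1)] that(2) by (auto simp: nested_arcs_def)
    \<comment> \<open>Vertices of \<open>Y1\<close> and \<open>Y2\<close> see all of
      \<open>X1\<close>, and those of \<open>X2\<close> reach it through \<open>Y1\<close>. From
      \<open>X1\<close> the closure then takes in \<open>Y1\<close> and \<open>Y2\<close>, and after
      that \<open>X2\<close>.\<close>
    consider "v \<in> X1" | "v \<in> X2" | "v \<in> Y1" | "v \<in> Y2" using S V by auto
    then have "\<exists>a \<in> S. a \<in> X1"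
      by cases (use S(2) ne X2 Y1 Y2 in \<open>meson ex_in_conv subsetD Un_upper1 \<close>)+
    then have "Y1 \<union> Y2 \<subseteq> S" using X1 by blast
    moreover from this have "X1 \<union> X2 \<subseteq> S" using Y1 ne by blast
    ultimately show ?thesis using S V by blast
  qed
  note PF = G neV E HV symH zpos
  show "graph_rho G \<le> sqrt L"
    using graph_rho_le_supergraph[OF PF Hz] by (simp add: \<rho>_def)
  show "graph_rho G = sqrt L \<longleftrightarrow> parcs G = ?H"
  proof
    assume eq: "graph_rho G = sqrt L"
    show "parcs G = ?H"
      by (rule graph_rho_eq_supergraph[OF PF]) (fact Hz eq[unfolded \<rho>_def[symmetric]] conn)+
  next
    assume "parcs G = ?H"
    from graph_rho_positive_eigenvector[OF PF Hz this] show "graph_rho G = sqrt L"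
      by (simp add: \<rho>_def)
  qed
qed

text \<open>The analogue for a complete bipartite supergraph, with weight
  \<open>sqrt (card Y)\<close> on \<open>X\<close> and \<open>sqrt (card X)\<close> on
  \<open>Y\<close>. It covers the case where the nested structure has an empty class.\<close>

lemma
  assumes G: "pair_graph G" and V: "pverts G = X \<union> Y" and disj: "X \<inter> Y = {}"
    and ne: "X \<noteq> {}" "Y \<noteq> {}" and E: "parcs G \<subseteq> X \<times> Y \<union> Y \<times> X"
  defines "L \<equiv> real (card X) * real (card Y)"
  shows graph_rho_le_bipartite: "graph_rho G \<le> sqrt L"
    and graph_rho_eq_bipartite: "graph_rho G = sqrt L \<longleftrightarrow> parcs G = X \<times> Y \<union> Y \<times> X"
proof -
  interpret pair_graph G by (rule G)
  let ?H = "X \<times> Y \<union> Y \<times> X"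
  have fin: "finite X" "finite Y" using pair_finite_verts V by auto
  define p q where pq: "p = sqrt (real (card X))" "q = sqrt (real (card Y))"
  have pos: "p > 0" "q > 0" using fin ne by (auto simp: pq card_gt_0_iff)
  have sq: "real (card X) = p * p" "real (card Y) = q * q" by (simp_all add: pq)
  have L: "sqrt L = p * q" by (simp add: L_def pq real_sqrt_mult)
  define z where "z v = (if v \<in> X then q else p)" for v
  have zpos: "z v > 0" for v using pos by (simp add: z_def)
  have Hz: "(\<Sum>u\<in>pverts G. if (v, u) \<in> ?H then z u else 0) = p * q * z v" if v: "v \<in> pverts G" for v
  proof -
    have "(\<Sum>u\<in>pverts G. if (v, u) \<in> ?H then z u else 0) =
      (\<Sum>u\<in>X. if (v, u) \<in> ?H then z u else 0) + (\<Sum>u\<in>Y. if (v, u) \<in> ?H then z u else 0)"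
      unfolding V using fin disj by (rule sum.union_disjoint)
    also have "(\<Sum>u\<in>X. if (v, u) \<in> ?H then z u else 0) = (\<Sum>u\<in>X. if v \<in> Y then q else 0)"
      using disj by (intro sum.cong) (auto simp: z_def)
    also have "(\<Sum>u\<in>Y. if (v, u) \<in> ?H then z u else 0) = (\<Sum>u\<in>Y. if v \<in> X then p else 0)"
      using disj by (intro sum.cong) (auto simp: z_def)
    finally show ?thesis using v V disj by (auto simp: z_def sq)
  qed
  have neV: "pverts G \<noteq> {}" using V ne by auto
  have HV: "?H \<subseteq> pverts G \<times> pverts G" by (auto simp: V)
  have symH: "sym ?H" by (auto simp: sym_def)
  have conn: "S = pverts G" if S: "S \<subseteq> pverts G" "v \<in> S"
    and cl: "\<And>a b. a \<in> S \<Longrightarrow> (a, b) \<in> ?H \<Longrightarrow> b \<in> S" for S v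
  proof -
    have X: "Y \<subseteq> S" if "a \<in> S" "a \<in> X" for a using cl[OF that(1)] that(2) by auto
    have Y: "X \<subseteq> S" if "a \<in> S" "a \<in> Y" for a using cl[OF that(1)] that(2) by auto
    have "X \<subseteq> S \<and> Y \<subseteq> S" using X Y S V ne by blast
    then show ?thesis using S V by blast
  qed
  note PF = G neV E HV symH zpos
  show "graph_rho G \<le> sqrt L"
    using graph_rho_le_supergraph[OF PF Hz] by (simp add: L)
  show "graph_rho G = sqrt L \<longleftrightarrow> parcs G = ?H"
  proof
    assume eq: "graph_rho G = sqrt L"
    show "parcs G = ?H"
      by (rule graph_rho_eq_supergraph[OF PF]) (fact Hz eq[unfolded L] conn)+
  next
    assume "parcs G = ?H"
    from graph_rho_positive_eigenvector[OF PF Hz this] show "graph_rho G = sqrt L"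
      by (simp add: L)
  qed
qed

section \<open>Identification with the concrete template graphs\<close>

text \<open>Adjacency depends only on the classes, so bijections between corresponding classes can
  be chosen freely and glued. Empty classes are allowed, which also handles complete bipartite
  graphs.\<close>

lemma graph_iso_nested_arcs:
  assumes G: "pair_graph G" and H: "pair_graph H"
    and VG: "pverts G = X1 \<union> X2 \<union> Y1 \<union> Y2" and VH: "pverts H = A1 \<union> A2 \<union> B1 \<union> B2"
    and dG: "X1 \<inter> X2 = {}" "Y1 \<inter> Y2 = {}" "(X1 \<union> X2) \<inter> (Y1 \<union> Y2) = {}"
    and dH: "A1 \<inter> A2 = {}" "B1 \<inter> B2 = {}" "(A1 \<union> A2) \<inter> (B1 \<union> B2) = {}"
    and card: "card X1 = card A1" "card X2 = card A2" "card Y1 = card B1" "card Y2 = card B2"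
    and EG: "parcs G = nested_arcs X1 X2 Y1 Y2" and EH: "parcs H = nested_arcs A1 A2 B1 B2"
  shows "graph_iso G H"
proof -
  have fin: "finite X1" "finite X2" "finite Y1" "finite Y2"
    "finite A1" "finite A2" "finite B1" "finite B2"
    using pair_fin_digraph.pair_finite_verts[of G] pair_fin_digraph.pair_finite_verts[of H] G H VG VH
    by (simp_all add: pair_graph_def pair_digraph_def)
  obtain f1 where f1: "bij_betw f1 X1 A1" using finite_same_card_bij[OF fin(1,5) card(1)] ..
  obtain f2 where f2: "bij_betw f2 X2 A2" using finite_same_card_bij[OF fin(2,6) card(2)] ..
  obtain f3 where f3: "bij_betw f3 Y1 B1" using finite_same_card_bij[OF fin(3,7) card(3)] ..
  obtain f4 where f4: "bij_betw f4 Y2 B2" using finite_same_card_bij[OF fin(4,8) card(4)] ..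
  define f where "f v = (if v \<in> X1 then f1 v else if v \<in> X2 then f2 v else if v \<in> Y1 then f3 v else f4 v)" for v
  have f: "bij_betw f X1 A1" "bij_betw f X2 A2" "bij_betw f Y1 B1" "bij_betw f Y2 B2"
  proof -
    have "bij_betw f X1 A1 = bij_betw f1 X1 A1" by (rule bij_betw_cong) (simp add: f_def)
    moreover have "bij_betw f X2 A2 = bij_betw f2 X2 A2"
      by (rule bij_betw_cong) (use dG in \<open>auto simp: f_def\<close>)
    moreover have "bij_betw f Y1 B1 = bij_betw f3 Y1 B1"
      by (rule bij_betw_cong) (use dG in \<open>auto simp: f_def\<close>)
    moreover have "bij_betw f Y2 B2 = bij_betw f4 Y2 B2"
      by (rule bij_betw_cong) (use dG in \<open>auto simp: f_def\<close>)
    ultimately show "bij_betw f X1 A1" "bij_betw f X2 A2" "bij_betw f Y1 B1" "bij_betw f Y2 B2"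
      using f1 f2 f3 f4 by simp_all
  qed
  have "bij_betw f (X1 \<union> X2 \<union> Y1 \<union> Y2) (A1 \<union> A2 \<union> B1 \<union> B2)"
    by (intro bij_betw_combine f) (use dH in auto)
  then have bij: "bij_betw f (pverts G) (pverts H)" by (simp add: VG VH)
  have mem: "f v \<in> A1 \<longleftrightarrow> v \<in> X1" "f v \<in> A2 \<longleftrightarrow> v \<in> X2" "f v \<in> B1 \<longleftrightarrow> v \<in> Y1" "f v \<in> B2 \<longleftrightarrow> v \<in> Y2"
    if "v \<in> pverts G" for v
  proof -
    have sub: "v \<in> X1 \<Longrightarrow> f v \<in> A1" "v \<in> X2 \<Longrightarrow> f v \<in> A2" "v \<in> Y1 \<Longrightarrow> f v \<in> B1" "v \<in> Y2 \<Longrightarrow> f v \<in> B2"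
      using f by (auto simp: bij_betw_def)
    then show "f v \<in> A1 \<longleftrightarrow> v \<in> X1" "f v \<in> A2 \<longleftrightarrow> v \<in> X2" "f v \<in> B1 \<longleftrightarrow> v \<in> Y1" "f v \<in> B2 \<longleftrightarrow> v \<in> Y2"
      using that dH unfolding VG by blast+
  qed
  show ?thesis
    by (rule graph_isoI[OF G H bij]) (simp add: EG EH nested_arcs_def mem)
qed

lemma pverts_double_nested_graph:
  "pverts (double_nested_graph p1 p2 q1 q2) =
     Inl ` {..<p1} \<union> Inl ` {p1..<p1 + p2} \<union> Inr ` {..<q1} \<union> Inr ` {q1..<q1 + q2}"
  by (simp add: double_nested_graph_def Let_def)

lemma parcs_double_nested_graph:
  "parcs (double_nested_graph p1 p2 q1 q2) =
     nested_arcs (Inl ` {..<p1}) (Inl ` {p1..<p1 + p2}) (Inr ` {..<q1}) (Inr ` {q1..<q1 + q2})"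
  unfolding double_nested_graph_def Let_def nested_arcs_def by auto

lemma parcs_complete_bipartite_graph:
  "parcs (complete_bipartite_graph a b) = Inl ` {..<a} \<times> Inr ` {..<b} \<union> Inr ` {..<b} \<times> Inl ` {..<a}"
  by (simp add: complete_bipartite_graph_def Let_def)

lemma pverts_complete_bipartite_graph:
  "pverts (complete_bipartite_graph a b) = Inl ` {..<a} \<union> Inr ` {..<b}"
  by (simp add: complete_bipartite_graph_def Let_def)

lemma pair_graph_complete_bipartite_graph: "pair_graph (complete_bipartite_graph a b)"
proof -
  let ?G = "complete_bipartite_graph a b"
  have "finite (pverts ?G)" "finite (parcs ?G)" "sym (parcs ?G)"
    by (auto simp: pverts_complete_bipartite_graph parcs_complete_bipartite_graph sym_def)
  moreover have "fst e \<in> pverts ?G \<and> snd e \<in> pverts ?G \<and> fst e \<noteq> snd e" if "e \<in> parcs ?G" for e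
    using that by (auto simp: pverts_complete_bipartite_graph parcs_complete_bipartite_graph)
  ultimately show ?thesis
    by unfold_locales (simp_all add: symmetric_def)
qed

lemma graph_iso_double_nested_graph:
  assumes "pair_graph G" "pverts G = X1 \<union> X2 \<union> Y1 \<union> Y2"
    and "X1 \<inter> X2 = {}" "Y1 \<inter> Y2 = {}" "(X1 \<union> X2) \<inter> (Y1 \<union> Y2) = {}"
    and "parcs G = nested_arcs X1 X2 Y1 Y2"
  shows "graph_iso G (double_nested_graph (card X1) (card X2) (card Y1) (card Y2))"
  by (rule graph_iso_nested_arcs[OF assms(1) pair_graph_double_nested_graph assms(2)
        pverts_double_nested_graph assms(3-5) _ _ _ _ _ _ _ assms(6) parcs_double_nested_graph])
    (auto simp: card_image)

lemma graph_iso_complete_bipartite_graph: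
  assumes "pair_graph G" "pverts G = X \<union> Y" "X \<inter> Y = {}" "parcs G = X \<times> Y \<union> Y \<times> X"
  shows "graph_iso G (complete_bipartite_graph (card X) (card Y))"
  by (rule graph_iso_nested_arcs[where ?X1.0 = X and ?X2.0 = "{}" and ?Y1.0 = Y and ?Y2.0 = "{}"
        and ?A1.0 = "Inl ` {..<card X}" and ?A2.0 = "{}" and ?B1.0 = "Inr ` {..<card Y}" and ?B2.0 = "{}"])
    (use assms pair_graph_complete_bipartite_graph in
      \<open>auto simp: nested_arcs_def card_image pverts_complete_bipartite_graph parcs_complete_bipartite_graph\<close>)

lemma graph_rho_double_nested_graph:
  assumes "p1 > 0" "p2 > 0" "q1 > 0" "q2 > 0"
  shows "graph_rho (double_nested_graph p1 p2 q1 q2) = sqrt (nested_root (real p1) (real p2) (real q1) (real q2))"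
proof -
  have "graph_rho (double_nested_graph p1 p2 q1 q2) =
      sqrt (nested_root (real (card (Inl ` {..<p1} :: (nat + nat) set)))
        (real (card (Inl ` {p1..<p1 + p2} :: (nat + nat) set)))
        (real (card (Inr ` {..<q1} :: (nat + nat) set)))
        (real (card (Inr ` {q1..<q1 + q2} :: (nat + nat) set))))"
    by (rule iffD2[OF graph_rho_eq_nested[OF pair_graph_double_nested_graph
          pverts_double_nested_graph] parcs_double_nested_graph])
      (use assms in \<open>auto simp: parcs_double_nested_graph\<close>)
  then show ?thesis by (simp add: card_image)
qed

lemma graph_rho_complete_bipartite_graph:
  assumes "a > 0" "b > 0"
  shows "graph_rho (complete_bipartite_graph a b) = sqrt (real a * real b)"
  using graph_rho_eq_bipartite[OF pair_graph_complete_bipartite_graph pverts_complete_bipartite_graph,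
      of a b] assms
  by (auto simp: parcs_complete_bipartite_graph card_image)

section \<open>Binding number\<close>

text \<open>The minimum must be attained, so its set has to be finite and nonempty. Singletons
  supply a member: a vertex is never its own neighbour.\<close>

lemma binding_number_less:
  assumes G: "pair_graph G" and ne: "pverts G \<noteq> {}" and b: "binding_number G < c"
  obtains S where "S \<noteq> {}" "S \<subseteq> pverts G" "real (card (nbhd G S)) / real (card S) < c"
proof -
  interpret pair_graph G by (rule G)
  let ?M = "{real (card (nbhd G S)) / real (card S) | S.
            S \<noteq> {} \<and> S \<subseteq> pverts G \<and> nbhd G S \<noteq> pverts G}"
  have "?M \<subseteq> (\<lambda>S. real (card (nbhd G S)) / real (card S)) ` Pow (pverts G)" by auto
  then have fin: "finite ?M"
    by (rule finite_subset) (simp add: pair_finite_verts)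
  obtain v where v: "v \<in> pverts G" using ne by auto
  have "v \<notin> nbhd G {v}" using pair_no_loops[of "(v, v)"] by (auto simp: nbhd_def)
  then have "nbhd G {v} \<noteq> pverts G" using v by auto
  then have "real (card (nbhd G {v})) / real (card {v}) \<in> ?M" using v by blast
  then have "Min ?M \<in> ?M" using fin by (intro Min_in) auto
  then have "binding_number G \<in> ?M" unfolding binding_number_def .
  then obtain S where "S \<noteq> {}" "S \<subseteq> pverts G"
    "binding_number G = real (card (nbhd G S)) / real (card S)"
    by blast
  then show ?thesis using that b by metis
qed

text \<open>Take \<open>Y1\<close> as the neighbourhood of \<open>A\<close> and cut \<open>A\<close>
  down to a set \<open>X2\<close> of exactly \<open>r * card Y1 + 1\<close> vertices, whose arcs
  still end in \<open>Y1\<close>. The last clause leaves two cases for later: \<open>Y2\<close> is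
  empty, or all four classes are nonempty.\<close>

lemma bipartite_expanding_side:
  assumes G: "pair_graph G" and V: "pverts G = X \<union> Y" and disj: "X \<inter> Y = {}"
    and E: "parcs G \<subseteq> X \<times> Y \<union> Y \<times> X" and ni: "no_isolated_vertices G"
    and A: "A \<subseteq> X" and less: "r * card (nbhd G A) < card A"
  shows "\<exists>X1 X2 Y1 Y2. pverts G = X1 \<union> X2 \<union> Y1 \<union> Y2 \<and> X1 \<inter> X2 = {} \<and> Y1 \<inter> Y2 = {} \<and>
      (X1 \<union> X2) \<inter> (Y1 \<union> Y2) = {} \<and> parcs G \<subseteq> nested_arcs X1 X2 Y1 Y2 \<and>
      card X2 = r * card Y1 + 1 \<and> Y1 \<noteq> {} \<and> (X1 = {} \<longrightarrow> Y2 = {})"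
proof -
  interpret pair_graph G by (rule G)
  have fin: "finite X" "finite Y" using pair_finite_verts V by auto
  let ?T = "nbhd G A"
  obtain B where B: "B \<subseteq> A" "card B = r * card ?T + 1"
    using obtain_subset_with_card_n[of "r * card ?T + 1" A] less by auto
  have T: "?T \<subseteq> Y" using E A disj by (auto simp: nbhd_def)
  have sym: "(u, v) \<in> parcs G \<longleftrightarrow> (v, u) \<in> parcs G" for u v
    using pair_sym_arcs by (auto simp: symmetric_def sym_def)
  obtain a where a: "a \<in> A" using less by fastforce
  then have "nbhd G {a} \<noteq> {}" using ni A V by (auto simp: no_isolated_vertices_def)
  then have Tne: "?T \<noteq> {}" using a by (auto simp: nbhd_def)
  have BT: "v \<in> ?T" if "(u, v) \<in> parcs G" "u \<in> B" for u v
    using that B by (auto simp: nbhd_def)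
  have sub: "parcs G \<subseteq> nested_arcs (X - B) B ?T (Y - ?T)"
  proof (rule subrelI)
    fix u v assume uv: "(u, v) \<in> parcs G"
    then have vu: "(v, u) \<in> parcs G" using sym by simp
    show "(u, v) \<in> nested_arcs (X - B) B ?T (Y - ?T)"
      using uv BT[OF uv] BT[OF vu] E T by (auto simp: nested_arcs_def)
  qed
  have iso: "Y - ?T = {}" if "X - B = {}"
  proof (rule ccontr)
    assume "Y - ?T \<noteq> {}"
    then obtain y where y: "y \<in> Y" "y \<notin> ?T" by auto
    then have "nbhd G {y} \<noteq> {}" using ni V by (simp add: no_isolated_vertices_def)
    then obtain u where "(y, u) \<in> parcs G" by (auto simp: nbhd_def)
    then have "(u, y) \<in> parcs G" "u \<in> X" using sym E y disj by auto
    then show False using BT that y by auto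
  qed
  have "B \<subseteq> X" using B A by auto
  then have *: "(X - B) \<union> B = X" "?T \<union> (Y - ?T) = Y" using T by auto
  have "pverts G = (X - B) \<union> B \<union> ?T \<union> (Y - ?T)" using V * by blast
  moreover have "((X - B) \<union> B) \<inter> (?T \<union> (Y - ?T)) = {}" unfolding * by (rule disj)
  moreover have "(X - B) \<inter> B = {}" "?T \<inter> (Y - ?T) = {}" by auto
  ultimately show ?thesis using sub B(2) Tne iso by metis
qed

text \<open>The witness splits along the two parts, and the two neighbourhoods lie in opposite
  parts. Both cardinalities are therefore additive, and the strict inequality must hold for at least
  one half.\<close>

lemma binding_number_structure:
  assumes G: "pair_graph G" and ne: "pverts G \<noteq> {}" and bip: "bipartite G"
    and ni: "no_isolated_vertices G" and r: "r \<ge> 1" and b: "binding_number G < 1 / real r"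
  obtains X1 X2 Y1 Y2 where "pverts G = X1 \<union> X2 \<union> Y1 \<union> Y2" "X1 \<inter> X2 = {}" "Y1 \<inter> Y2 = {}"
    "(X1 \<union> X2) \<inter> (Y1 \<union> Y2) = {}" "parcs G \<subseteq> nested_arcs X1 X2 Y1 Y2"
    "card X2 = r * card Y1 + 1" "Y1 \<noteq> {}" "X1 = {} \<longrightarrow> Y2 = {}"
proof -
  interpret pair_graph G by (rule G)
  obtain X Y where V: "pverts G = X \<union> Y" and disj: "X \<inter> Y = {}"
    and E: "parcs G \<subseteq> X \<times> Y \<union> Y \<times> X"
    using bip unfolding bipartite_def by auto
  have fin: "finite X" "finite Y" using pair_finite_verts V by auto
  obtain S where S: "S \<noteq> {}" "S \<subseteq> pverts G" "real (card (nbhd G S)) / real (card S) < 1 / real r"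
    using binding_number_less[OF G ne b] by blast
  have finS: "finite S" using S fin V finite_subset by fastforce
  then have "card S > 0" using S by (simp add: card_gt_0_iff)
  then have "real (r * card (nbhd G S)) < real (card S)"
    using S(3) r by (simp add: field_simps)
  then have less: "r * card (nbhd G S) < card S" by (simp only: of_nat_less_iff)
  have SXY: "S = (S \<inter> X) \<union> (S \<inter> Y)" using S V by auto
  have N: "nbhd G S = nbhd G (S \<inter> X) \<union> nbhd G (S \<inter> Y)"
    using S(2) unfolding V by (auto simp: nbhd_def)
  have "nbhd G (S \<inter> X) \<subseteq> Y" "nbhd G (S \<inter> Y) \<subseteq> X" using E disj by (auto simp: nbhd_def)
  then have "card (nbhd G S) = card (nbhd G (S \<inter> X)) + card (nbhd G (S \<inter> Y))"
    unfolding N using fin disj by (intro card_Un_disjoint) (auto intro: finite_subset)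
  moreover have "card S = card (S \<inter> X) + card (S \<inter> Y)"
    by (subst SXY, rule card_Un_disjoint) (use finS disj in auto)
  ultimately have side: "r * card (nbhd G (S \<inter> X)) < card (S \<inter> X) \<or> r * card (nbhd G (S \<inter> Y)) < card (S \<inter> Y)"
    using less by (metis add_mono distrib_left not_less)
  have V': "pverts G = Y \<union> X" "Y \<inter> X = {}" "parcs G \<subseteq> Y \<times> X \<union> X \<times> Y"
    using V disj E by auto
  from side have "\<exists>X1 X2 Y1 Y2. pverts G = X1 \<union> X2 \<union> Y1 \<union> Y2 \<and> X1 \<inter> X2 = {} \<and> Y1 \<inter> Y2 = {} \<and>
      (X1 \<union> X2) \<inter> (Y1 \<union> Y2) = {} \<and> parcs G \<subseteq> nested_arcs X1 X2 Y1 Y2 \<and>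
      card X2 = r * card Y1 + 1 \<and> Y1 \<noteq> {} \<and> (X1 = {} \<longrightarrow> Y2 = {})"
  proof (elim disjE)
    assume "r * card (nbhd G (S \<inter> X)) < card (S \<inter> X)"
    then show ?thesis by (rule bipartite_expanding_side[OF G V disj E ni Int_lower2])
  next
    assume "r * card (nbhd G (S \<inter> Y)) < card (S \<inter> Y)"
    then show ?thesis by (rule bipartite_expanding_side[OF G V' ni Int_lower2])
  qed
  then show ?thesis using that by blast
qed

section \<open>Numerical comparison\<close>

text \<open>Monotonicity of \<open>x * (n - x)\<close> below \<open>n / 2\<close>, used to compare
  complete bipartite graphs on \<open>n\<close> vertices; the difference factors as
  \<open>(m - t) * (n - m - t)\<close>.\<close>

lemma product_constant_sum_less:
  fixes t m n :: real
  assumes "t < m" "t + m < n"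
  shows "t * (n - t) < m * (n - m)"
proof -
  have "0 < (m - t) * (n - m - t)" using assms by simp
  then show ?thesis by (simp add: algebra_simps)
qed

lemma product_constant_sum_le:
  fixes t m n :: real
  assumes "t \<le> m" "t + m \<le> n"
  shows "t * (n - t) \<le> m * (n - m)"
proof -
  have "0 \<le> (m - t) * (n - m - t)" using assms by simp
  then show ?thesis by (simp add: algebra_simps)
qed

lemma four_times_product_le: "4 * (x * y) \<le> (x + y)\<^sup>2" for x y :: real
  using zero_le_power2[of "x - y"] by (simp add: power2_eq_square algebra_simps)

lemma double_div_le: "2 * ((n - 1) div (r + 1)) \<le> n - 1" if "r \<ge> 1" for n r :: nat
proof -
  have "2 * ((n - 1) div (r + 1)) \<le> (r + 1) * ((n - 1) div (r + 1))" using that by simp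
  also have "\<dots> \<le> n - 1" by (rule times_div_less_eq_dividend)
  finally show ?thesis .
qed

text \<open>For \<open>r = 1\<close> the edge count is \<open>p * (q + t) + t * (t + 1)\<close>. The
  first product is bounded by its factors' sum \<open>n - 1 - t\<close>. The strict inequality
  needed later comes from \<open>nested_root_less_edges\<close>.\<close>

lemma nested_edges_case_one:
  fixes n t p q :: nat
  assumes n: "p + q + 2 * t + 1 = n" and q: "q \<ge> 1" and p: "p > t" and t: "t \<ge> 1"
  defines "m \<equiv> (n - 1) div 2"
  shows "real p * t + real p * q + (real t + 1) * t \<le> real m * (real n - real m)"
proof -
  have "real p * t + real p * q + (real t + 1) * t = real p * (real q + real t) + t * t + t"
    by (simp add: algebra_simps)
  moreover have "real p + (real q + real t) = real n - 1 - t" using n by simp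
  then have "4 * (real p * (real q + real t)) \<le> (real n - 1 - t)\<^sup>2"
    using four_times_product_le[of "real p" "real q + real t"] by (simp only:)
  ultimately have "4 * (real p * t + real p * q + (real t + 1) * t) \<le> (real n - 1 - t)\<^sup>2 + 4 * t * t + 4 * t"
    by simp
  also have "\<dots> \<le> real n * n - 4"
  proof -
    \<comment> \<open>This combines \<open>p \<ge> t + 1\<close> and \<open>q \<ge> 1\<close> with
      the vertex count.\<close>
    have "real (3 * t + 3) \<le> real n" using n q p by linarith
    then have "2 * (3 * real t + 2) * (real t + 1) \<le> 2 * (real n - 1) * (real t + 1)"
      by (intro mult_right_mono mult_left_mono) auto
    then show ?thesis
      by (simp add: power2_eq_square algebra_simps) (use zero_le_square[of "real t"] in linarith)
  qed
  also have "\<dots> \<le> 4 * (real m * (real n - real m))"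
  proof -
    \<comment> \<open>Here \<open>4 * m * (n - m) = n^2 - (n - 2 * m)^2\<close>, and
      \<open>n - 2 * m\<close> is 1 or 2.\<close>
    have "n = 2 * m + 1 \<or> n = 2 * m + 2" using n unfolding m_def by presburger
    then show ?thesis by (auto simp: algebra_simps)
  qed
  finally show ?thesis by simp
qed

text \<open>
  The edge bound \<open>(N - r t)\<^sup>2 + 4 (r t\<^sup>2 + t)\<close> is convex in \<open>t\<close>, hence largest at an end of the
  range \<open>2 \<le> t \<le> T = N / (r + 2)\<close>. At \<open>T\<close> it is four times \<open>T (n - T)\<close>. For small \<open>r\<close> and \<open>n\<close>
  the value at \<open>2\<close> is below the first bound only.
\<close>

lemma nested_edges_case_ge_two:
  fixes r n t p q :: nat
  assumes r: "r \<ge> 2" and nr: "n \<ge> r\<^sup>2 + r + 2" and t: "t \<ge> 2"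
    and n: "p + q + (r + 1) * t + 1 = n" and q: "q \<ge> 1" and p: "p > t"
  defines "m \<equiv> (n - 1) div (r + 1)"
  shows "4 * (real p * t + real p * q + (real r * t + 1) * t)
    \<le> max (4 * (real m * (real n - real m))) ((real n - 1 - r)\<^sup>2 - 1)" (is "4 * ?e \<le> ?M")
proof -
  define N where "N = real n - 1"
  define T where "T = N / (real r + 2)"
  define C D where CD: "C = real r * r + 4 * r" "D = 4 - 2 * real r * N"
  define f where "f x = C * x * x + D * x + N * N" for x
  have f: "f x = (N - real r * x)\<^sup>2 + 4 * (real r * x * x + x)" for x
    by (simp add: f_def CD power2_eq_square algebra_simps)
  have "?e = real p * (real q + real t) + (real r * t * t + t)" by (simp add: algebra_simps)
  moreover have "real p + (real q + real t) = N - real r * t"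
    using n by (auto simp: N_def algebra_simps)
  then have "4 * (real p * (real q + real t)) \<le> (N - real r * t)\<^sup>2"
    using four_times_product_le[of "real p" "real q + real t"] by (simp only:)
  ultimately have e: "4 * ?e \<le> f t" by (simp add: f)
  have "(r + 2) * t \<le> n - 1" using n q p by (simp add: algebra_simps)
  then have "real ((r + 2) * t) \<le> real (n - 1)" by (simp only: of_nat_le_iff)
  then have tT: "real t \<le> T"
    using r nr by (simp add: T_def N_def field_simps)
  \<comment> \<open>The quadratic lower bound on \<open>n\<close> gives \<open>r \<le> m\<close>,
    which absorbs the remainder of the division:
    \<open>n - 1 \<le> (r + 1) * m + r \<le> (r + 2) * m\<close>, that is,
    \<open>T \<le> m\<close>.\<close>
  have mr: "r \<le> m"
  proof -
    have "r * (r + 1) \<le> n - 1" using nr by (simp add: power2_eq_square)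
    then show ?thesis unfolding m_def by (simp add: less_eq_div_iff_mult_less_eq)
  qed
  have m2: "2 * m \<le> n - 1" unfolding m_def using double_div_le r by simp
  then have m2': "2 * real m \<le> real n" by linarith
  have "n - 1 < (r + 1) + (r + 1) * m" unfolding m_def by (rule dividend_less_times_div) simp
  then have "n - 1 \<le> (r + 2) * m" using mr by (simp add: algebra_simps)
  then have "real (n - 1) \<le> real ((r + 2) * m)" by (simp only: of_nat_le_iff)
  then have "N \<le> (real r + 2) * m" unfolding N_def using nr by (simp add: algebra_simps)
  then have Tm: "T \<le> m" using r by (simp add: T_def field_simps)
  have NT: "N = (real r + 2) * T" using r by (simp add: T_def)
  have "f T = 4 * (T * (real n - T))"
  proof -
    have "real n = (real r + 2) * T + 1" using NT by (simp add: N_def)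
    then show ?thesis unfolding f by (simp add: NT power2_eq_square algebra_simps)
  qed
  also have "\<dots> \<le> 4 * (real m * (real n - real m))"
    using product_constant_sum_le[of T m n] Tm m2' by linarith
  finally have fT: "f T \<le> ?M" by simp
  have f2: "f 2 \<le> ?M"
  proof (cases "r \<ge> 4 \<or> n \<ge> 15")
    case True
    \<comment> \<open>The right-hand side is exactly \<open>(N - r)^2 - 1 - f 2\<close>.\<close>
    have "0 \<le> real r * (2 * N - 3 * r) - 16 * r - 9"
    proof (cases "r \<ge> 4")
      case True
      have "r * r + r + 2 \<le> n" using nr by (simp add: power2_eq_square)
      then have "real (r * r + r + 2) \<le> real n" by (simp only: of_nat_le_iff)
      then have "real r * r + r + 1 \<le> N" by (simp add: N_def)
      then have "real r * (2 * (real r * r + r + 1) - 3 * r) \<le> real r * (2 * N - 3 * r)"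
        by (intro mult_left_mono) auto
      moreover have "4 * real r \<le> real r * r" using True by (intro mult_right_mono) auto
      then have "14 \<le> 2 * (real r * r) - r - 14" using True by linarith
      then have "4 * 14 \<le> real r * (2 * (real r * r) - r - 14)"
        using True by (intro mult_mono) auto
      ultimately show ?thesis by (simp add: algebra_simps)
    next
      case False
      then have "r = 2 \<or> r = 3" "n \<ge> 15" using r True by auto
      then show ?thesis by (auto simp: N_def)
    qed
    then have "f 2 \<le> (N - r)\<^sup>2 - 1"
      unfolding f by (simp add: power2_eq_square algebra_simps)
    then show ?thesis by (simp add: N_def)
  next
    case False
    then have rr: "r = 2 \<or> r = 3" using r by auto
    \<comment> \<open>Together with the lower bound on \<open>n\<close> this leaves five pairs of
      \<open>r\<close> and \<open>n\<close>, which are checked by evaluation.\<close>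
    have "(r + 2) * 2 + 3 \<le> n"
    proof -
      have "(r + 2) * 2 \<le> (r + 2) * t" using t by (rule mult_le_mono2)
      then show ?thesis using n q p by (simp add: algebra_simps)
    qed
    then have "(r = 2 \<and> (n = 11 \<or> n = 12 \<or> n = 13 \<or> n = 14)) \<or> (r = 3 \<and> n = 14)"
      using rr False nr by auto
    then have "f 2 \<le> 4 * (real m * (real n - real m))"
      unfolding f m_def N_def by (elim disjE conjE) simp_all
    then show ?thesis by simp
  qed
  \<comment> \<open>Convexity through chord slopes: otherwise the slope from \<open>2\<close> to
    \<open>t\<close> would be positive and the slope from \<open>t\<close> to \<open>T\<close>
    negative, although slopes of \<open>f\<close> increase.\<close>
  have "f t \<le> f 2 \<or> f t \<le> f T"
  proof (rule ccontr)
    assume "\<not> ?thesis"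
    then have "f t - f 2 > 0" "f T - f t < 0" by auto
    moreover have "f t - f 2 = (real t - 2) * (C * (real t + 2) + D)" "f T - f t = (T - t) * (C * (T + t) + D)"
      by (simp_all add: f_def algebra_simps)
    ultimately have 1: "C * (real t + 2) + D > 0" and 2: "C * (T + t) + D < 0"
      using t tT by (auto simp: zero_less_mult_iff mult_less_0_iff)
    have "C * (real t + 2) \<le> C * (T + t)"
      using t tT by (intro mult_left_mono) (auto simp: CD)
    then show False using 1 2 by simp
  qed
  then show ?thesis using e f2 fT by linarith
qed

section \<open>The optimal split for \<open>t = 1\<close>\<close>

text \<open>At \<open>L\<close>, the root for \<open>p\<close>, the quadratic for \<open>p0\<close>
  takes the value \<open>- (d * E)\<close>, so \<open>L\<close> is smaller than the new root once
  \<open>d\<close> and \<open>E\<close> have the same sign. For \<open>p < p0\<close> one gets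
  \<open>E \<ge> a\<close>; for \<open>p > p0\<close> one gets \<open>E \<le> 2 * a - L\<close>,
  which is why \<open>L \<le> 2 * a\<close> is treated apart.\<close>

lemma nested_root_balanced:
  fixes a p q p0 q0 L :: real
  assumes pos: "a > 0" "p > 0" "q > 0" "p0 > 0" "q0 > 0"
    and sum: "p + q = p0 + q0" and diff: "p \<le> p0 - 1 \<or> p \<ge> p0 + 1"
    and bal: "q0 + 1 \<le> p0" "p0 \<le> q0 + 2" and large: "2 * a \<le> p0 * (q0 + 1)"
  shows "nested_root p a 1 q < nested_root p0 a 1 q0"
proof (cases "nested_root p a 1 q \<le> 2 * a")
  case True
  have "p0 * (1 + q0) < nested_root p0 a 1 q0"
    by (rule nested_root_gt_left) (use pos in auto)
  then show ?thesis using True large by (simp add: add.commute)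
next
  case False
  define L where "L = nested_root p a 1 q"
  define d where "d = p0 - p"
  define E where "E = (q0 - p) * (L - a) + L"
  have L: "L > 2 * a" using False by (simp add: L_def)
  have eq: "L * L - (p * 1 + p * q + a * 1) * L + p * a * 1 * q = 0"
    unfolding L_def by (rule nested_root_eq) (use pos in auto)
  have q: "q = p0 + q0 - p" using sum by simp
  have "d * E > 0"
    using diff
  proof
    assume p: "p \<le> p0 - 1"
    have "-1 * (L - a) \<le> (q0 - p) * (L - a)"
      by (rule mult_right_mono) (use p bal L pos in auto)
    then have "E > 0" using pos by (simp add: E_def)
    then show ?thesis using p by (simp add: d_def)
  next
    assume p: "p \<ge> p0 + 1"
    have "(q0 - p) * (L - a) \<le> -2 * (L - a)"
      by (rule mult_right_mono) (use p bal L pos in auto)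
    then have "E < 0" using L by (simp add: E_def)
    then show ?thesis using p by (simp add: d_def zero_less_mult_iff)
  qed
  have "L * L - (p0 * 1 + p0 * q0 + a * 1) * L + p0 * a * 1 * q0 = - (d * E)"
    using eq unfolding q d_def E_def by (simp add: algebra_simps)
  with \<open>d * E > 0\<close> have "L < nested_root p0 a 1 q0"
    by (intro nested_root_gt) (use pos in auto)
  then show ?thesis by (simp add: L_def)
qed

text \<open>Here \<open>p0\<close> and \<open>q0 + 1\<close> are the upper and lower halves of
  \<open>n - r - 1\<close>. This number is at least 5, so the natural subtractions are not
  truncated.\<close>

lemma balanced_halves:
  fixes r n :: nat
  assumes r: "r \<ge> 2" and nr: "n \<ge> r\<^sup>2 + r + 2"
  defines "p0 \<equiv> (n - r) div 2" and "q0 \<equiv> (n - r - 1) div 2 - 1"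
  shows "p0 + q0 + 1 = n - r - 1" "p0 = q0 + 1 \<or> p0 = q0 + 2" "q0 \<ge> 1"
proof -
  have "r * r + 1 \<le> n - r - 1" "4 \<le> r * r"
    using nr mult_le_mono[OF r r] by (auto simp: power2_eq_square)
  then obtain k where k: "n - r - 1 = k" "n - r = k + 1" "k \<ge> 5" by fastforce
  obtain j where j: "k = 2 * j \<or> k = 2 * j + 1" by (meson evenE oddE)
  show "p0 + q0 + 1 = n - r - 1" "p0 = q0 + 1 \<or> p0 = q0 + 2" "q0 \<ge> 1"
    unfolding p0_def q0_def k(1,2) using k(3) j by auto
qed

text \<open>The numerical core: a nested supergraph is strictly beaten by the best complete
  bipartite graph or by the best nested graph, or has the parameters of the latter.\<close>

lemma nested_root_bound:
  fixes r n t p q :: nat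
  assumes r: "r \<ge> 1" and nr: "n \<ge> r\<^sup>2 + r + 2" and t: "t \<ge> 1"
    and n: "p + q + (r + 1) * t + 1 = n" and p: "p \<ge> 1" and q: "q \<ge> 1"
  defines "m \<equiv> (n - 1) div (r + 1)"
    and "p0 \<equiv> (n - r) div 2" and "q0 \<equiv> (n - r - 1) div 2 - 1"
    and "L \<equiv> nested_root (real p) (real (r * t + 1)) (real t) (real q)"
  shows "L < real m * (real n - real m) \<or>
    r \<ge> 2 \<and> (L < nested_root (real p0) (real (r + 1)) 1 (real q0) \<or> t = 1 \<and> p = p0 \<and> q = q0)"
proof -
  have e: "L < real p * t + real p * q + (real r * t + 1) * t"
    using nested_root_less_edges[of "real p" "real (r * t + 1)" "real t" "real q"] p q t
    by (simp add: L_def add_nonneg_pos add.commute[of 1])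
  have tm: "t \<le> m"
    unfolding m_def using n by (simp add: less_eq_div_iff_mult_less_eq algebra_simps)
  have m2: "2 * m \<le> n - 1" unfolding m_def using double_div_le r by simp
  then have m2': "2 * real m \<le> real n" by linarith
  show ?thesis
  proof (cases "p \<le> t")
    case True
    have "real n = real p + real q + (real r + 1) * t + 1" using n by (auto simp: algebra_simps)
    \<comment> \<open>Replacing \<open>p * q\<close> by \<open>t * q\<close> turns the edge count
      into \<open>t * (n - t)\<close>, the edge count of a complete bipartite graph.\<close>
    moreover have "real p * q \<le> real t * q" using True by (intro mult_right_mono) auto
    ultimately have "real p * t + real p * q + (real r * t + 1) * t \<le> t * (real n - t)"
      by (simp add: algebra_simps)
    also have "\<dots> \<le> real m * (real n - real m)"
      by (rule product_constant_sum_le) (use tm m2' in auto)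
    finally show ?thesis using e by simp
  next
    case False
    then have pt: "p > t" by simp
    consider "r = 1" | "r \<ge> 2" "t \<ge> 2" | "r \<ge> 2" "t = 1" using r t by linarith
    then show ?thesis
    proof cases
      case 1
      then have "m = (n - 1) div 2" by (simp add: m_def numeral_2_eq_2)
      moreover have "real r * t + 1 = real t + 1" using 1 by simp
      moreover have "p + q + 2 * t + 1 = n" using n 1 by simp
      ultimately show ?thesis
        using nested_edges_case_one[of p q t n] q pt t e by simp
    next
      case 3
      have n4: "r * r + 1 \<le> n - r - 1" "4 \<le> r * r"
        using nr 3(1) mult_le_mono[OF 3(1) 3(1)] by (auto simp: power2_eq_square)
      note h = balanced_halves[OF 3(1) nr, folded p0_def q0_def]
      have s: "p + q = p0 + q0" "q0 + 1 \<le> p0" "p0 \<le> q0 + 2" "q0 \<ge> 1"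
        using h n 3(2) by auto
      \<comment> \<open>The size condition of \<open>nested_root_balanced\<close> for
        \<open>a = r + 1\<close>. It is sharp for \<open>r = 2\<close> and \<open>n = 8\<close>,
        where \<open>p0 = 3\<close> and \<open>q0 + 1 = 2\<close>.\<close>
      have "2 * (r + 1) \<le> p0 * (q0 + 1)"
      proof (cases "r = 2")
        case True
        then have "p0 \<ge> 3" "q0 + 1 \<ge> 2" using n4 s h(1) by simp_all
        from mult_le_mono[OF this] show ?thesis using True by simp
      next
        case False
        then have "3 * r \<le> r * r" using 3(1) by simp
        then have "p0 \<ge> r + 1" "q0 + 1 \<ge> 2"
          using n4 s h(1) 3(1) by linarith+
        from mult_le_mono[OF this] show ?thesis by simp
      qed
      then have "real (2 * (r + 1)) \<le> real (p0 * (q0 + 1))" by (simp only: of_nat_le_iff)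
      then have large: "2 * real (r + 1) \<le> real p0 * (real q0 + 1)" by (simp add: algebra_simps)
      show ?thesis
      proof (cases "p = p0")
        case True
        then show ?thesis using s 3 by simp
      next
        case False
        have "nested_root (real p) (real (r + 1)) 1 (real q) < nested_root (real p0) (real (r + 1)) 1 (real q0)"
          by (rule nested_root_balanced) (use s p q False large in auto)
        then show ?thesis using 3 by (simp add: L_def)
      qed
    next
      case 2
      note s = balanced_halves[OF 2(1) nr, folded p0_def q0_def]
      have "n = p0 + q0 + r + 2" using s(1,3) by linarith
      then have *: "real n - 1 - r = real (p0 + q0 + 1)" by simp
      \<comment> \<open>The factors \<open>p0\<close> and \<open>q0 + 1\<close> differ by at most 1,
        so four times their product misses the square of their sum by at most 1.\<close>
      have "(real (p0 + q0 + 1))\<^sup>2 - 1 \<le> 4 * (real p0 * (1 + real q0))"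
        using s(2) by (auto simp: power2_eq_square algebra_simps)
      moreover have "real p0 * (1 + real q0) < nested_root (real p0) (real (r + 1)) 1 (real q0)"
        by (rule nested_root_gt_left) (use s in auto)
      ultimately have "(real n - 1 - r)\<^sup>2 - 1 < 4 * nested_root (real p0) (real (r + 1)) 1 (real q0)"
        unfolding * by linarith
      moreover define E where "E = real p * t + real p * q + (real r * t + 1) * t"
      have "L < E" using e by (simp add: E_def)
      moreover have "4 * E \<le> max (4 * (real m * (real n - real m))) ((real n - 1 - r)\<^sup>2 - 1)"
        using nested_edges_case_ge_two[OF 2(1) nr 2(2) n q pt] unfolding E_def m_def .
      ultimately have "4 * L < max (4 * (real m * (real n - real m)))
          (4 * nested_root (real p0) (real (r + 1)) 1 (real q0))"
        by linarith
      then show ?thesis using 2(1) unfolding less_max_iff_disj by auto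
    qed
  qed
qed

section \<open>The extremal theorem\<close>

text \<open>A single disjunction from which all four parts follow: \<open>G\<close> is one of the
  two candidates or lies strictly below one of them, the second candidate being available only for
  \<open>r \<ge> 2\<close>.\<close>

lemma graph_rho_bound:
  fixes r n :: nat
  assumes r: "r \<ge> 1" and nr: "n \<ge> r\<^sup>2 + r + 2"
    and G: "pair_graph G" and card: "card (pverts G) = n" and bip: "bipartite G"
    and ni: "no_isolated_vertices G" and b: "binding_number G < 1 / real r"
  defines "m \<equiv> (n - 1) div (r + 1)"
  defines "K \<equiv> complete_bipartite_graph (n - m) m"
    and "D \<equiv> double_nested_graph ((n - r) div 2) (r + 1) 1 ((n - r - 1) div 2 - 1)"
  shows "graph_iso G K \<or> graph_rho G < graph_rho K \<or>
    r \<ge> 2 \<and> (graph_iso G D \<or> graph_rho G < graph_rho D)"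
proof -
  interpret pair_graph G by (rule G)
  have "pverts G \<noteq> {}" using card nr by auto
  then obtain X1 X2 Y1 Y2 where V: "pverts G = X1 \<union> X2 \<union> Y1 \<union> Y2"
    and disj: "X1 \<inter> X2 = {}" "Y1 \<inter> Y2 = {}" "(X1 \<union> X2) \<inter> (Y1 \<union> Y2) = {}"
    and E: "parcs G \<subseteq> nested_arcs X1 X2 Y1 Y2"
    and X2: "card X2 = r * card Y1 + 1" and Y1: "Y1 \<noteq> {}" and X1Y2: "X1 = {} \<longrightarrow> Y2 = {}"
    using binding_number_structure[OF G _ bip ni r b] by blast
  have fin: "finite X1" "finite X2" "finite Y1" "finite Y2"
    using pair_finite_verts V by auto
  define p q t where pqt: "p = card X1" "q = card Y2" "t = card Y1"
  have t: "t \<ge> 1" using Y1 fin by (simp add: pqt Suc_le_eq card_gt_0_iff)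
  have X2ne: "X2 \<noteq> {}" using X2 by auto
  have cX: "card (X1 \<union> X2) = p + (r * t + 1)" and cY: "card (Y1 \<union> Y2) = t + q"
    using fin disj X2 by (simp_all add: pqt card_Un_disjoint)
  have "n = card (X1 \<union> X2) + card (Y1 \<union> Y2)"
    unfolding card[symmetric] V using fin disj by (subst card_Un_disjoint[symmetric]) (auto simp: Un_assoc)
  then have n: "p + q + (r + 1) * t + 1 = n" using cX cY by simp
  have tm: "t \<le> m"
    unfolding m_def using n by (simp add: less_eq_div_iff_mult_less_eq algebra_simps)
  have m2: "2 * m \<le> n - 1" unfolding m_def using double_div_le r by simp
  have K: "graph_rho K = sqrt (real m * (real n - real m))"
    using graph_rho_complete_bipartite_graph[of "n - m" m] m2 tm t nr
    by (simp add: K_def of_nat_diff mult.commute)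
  show ?thesis
  \<comment> \<open>With \<open>Y2\<close> empty the supergraph is complete bipartite with small
    side \<open>t\<close>; \<open>t < m\<close> is strictly worse than \<open>K\<close>, and
    \<open>t = m\<close> gives \<open>K\<close> itself.\<close>
  proof (cases "Y2 = {}")
    case True
    have V': "pverts G = (X1 \<union> X2) \<union> Y1" and d': "(X1 \<union> X2) \<inter> Y1 = {}"
      and ne': "X1 \<union> X2 \<noteq> {}"
      using V disj X2ne True by auto
    have E': "parcs G \<subseteq> (X1 \<union> X2) \<times> Y1 \<union> Y1 \<times> (X1 \<union> X2)"
      using E True by (auto simp: nested_arcs_def)
    have cX': "card (X1 \<union> X2) = n - t" "t \<le> n" using cX n True by (auto simp: pqt)
    have L: "real (card (X1 \<union> X2)) * real (card Y1) = real t * (real n - real t)"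
      using cX' by (simp add: pqt of_nat_diff)
    note le = graph_rho_le_bipartite[OF G V' d' ne' Y1 E', unfolded L]
    note eq = graph_rho_eq_bipartite[OF G V' d' ne' Y1 E', unfolded L]
    show ?thesis
    proof (cases "t = m")
      case False
      have "real t * (real n - real t) < real m * (real n - real m)"
        by (rule product_constant_sum_less) (use tm m2 False nr in linarith)+
      then have "graph_rho G < graph_rho K"
        using le unfolding K by (meson le_less_trans real_sqrt_less_mono)
      then show ?thesis by simp
    next
      case True
      show ?thesis
      proof (cases "graph_rho G = graph_rho K")
        case True
        then have "parcs G = (X1 \<union> X2) \<times> Y1 \<union> Y1 \<times> (X1 \<union> X2)"
          using eq \<open>t = m\<close> K by simp
        from graph_iso_complete_bipartite_graph[OF G V' d' this] show ?thesis
          using cX' \<open>t = m\<close> by (simp add: K_def pqt(3))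
      next
        case False
        then show ?thesis using le \<open>t = m\<close> K by simp
      qed
    qed
  next
    case False
    then have ne: "X1 \<noteq> {}" "X2 \<noteq> {}" "Y1 \<noteq> {}" "Y2 \<noteq> {}" using X1Y2 X2ne Y1 by auto
    then have pq: "p \<ge> 1" "q \<ge> 1" using fin by (simp_all add: pqt Suc_le_eq card_gt_0_iff)
    define L where "L = nested_root (real p) (real (r * t + 1)) (real t) (real q)"
    define p0 q0 where pq0: "p0 = (n - r) div 2" "q0 = (n - r - 1) div 2 - 1"
    have LL: "nested_root (real (card X1)) (real (card X2)) (real (card Y1)) (real (card Y2)) = L"
      by (simp add: L_def X2 pqt)
    note le = graph_rho_le_nested[OF G V disj ne E, unfolded LL]
    note eq = graph_rho_eq_nested[OF G V disj ne E, unfolded LL]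
    have Dpq: "D = double_nested_graph p0 (r + 1) 1 q0" by (simp only: D_def pq0)
    have D: "graph_rho D = sqrt (nested_root (real p0) (real (r + 1)) 1 (real q0))" if "r \<ge> 2"
    proof -
      have "p0 > 0" "q0 > 0" using balanced_halves[OF that nr, folded pq0] by auto
      then show ?thesis
        using graph_rho_double_nested_graph[of p0 "r + 1" 1 q0] by (simp add: Dpq)
    qed
    consider "L < real m * (real n - real m)"
      | "r \<ge> 2" "L < nested_root (real p0) (real (r + 1)) 1 (real q0)"
      | "r \<ge> 2" "t = 1" "p = p0" "q = q0"
      using nested_root_bound[OF r nr t n pq] unfolding L_def m_def pq0 by blast
    then show ?thesis
    proof cases
      case 1
      then show ?thesis
        using le K by (metis le_less_trans real_sqrt_less_mono)
    next
      case 2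
      then show ?thesis
        using le D by (metis le_less_trans real_sqrt_less_mono)
    next
      case 3
      have LD: "graph_rho D = sqrt L" using D 3 by (simp add: L_def)
      show ?thesis
      proof (cases "graph_rho G = sqrt L")
        case True
        then have "parcs G = nested_arcs X1 X2 Y1 Y2" using eq by simp
        from graph_iso_double_nested_graph[OF G V disj this] have "graph_iso G D"
          using 3 X2 by (simp add: Dpq pqt)
        then show ?thesis using 3(1) by simp
      next
        case False
        then show ?thesis using le LD 3(1) by simp
      qed
    qed
  qed
qed

section \<open>Real floors and ceilings as natural divisions\<close>

lemma nat_floor_divide: "nat \<lfloor>(real n - 1) / (real r + 1)\<rfloor> = (n - 1) div (r + 1)" if "n \<ge> 1"
proof -
  have "(real n - 1) / (real r + 1) = real (n - 1) / real (r + 1)" using that by (simp add: of_nat_diff)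
  then show ?thesis by (simp only: floor_divide_of_nat_eq nat_int)
qed

lemma nat_floor_half: "nat \<lfloor>(real n - real r - 1) / 2\<rfloor> = (n - r - 1) div 2" if "n \<ge> r + 1"
proof -
  have "(real n - real r - 1) / 2 = real (n - r - 1) / real 2" using that by (simp add: of_nat_diff)
  then show ?thesis by (simp only: floor_divide_of_nat_eq nat_int)
qed

lemma nat_ceiling_half: "nat \<lceil>(real n - real r - 1) / 2\<rceil> = (n - r) div 2" if le: "n \<ge> r + 1"
proof -
  obtain k where k: "n = r + 1 + k" using le_Suc_ex[OF le] by auto
  obtain j where "k = 2 * j \<or> k = 2 * j + 1" by (meson evenE oddE)
  then have "\<lceil>real k / 2\<rceil> = int ((k + 1) div 2)"
  proof
    assume "k = 2 * j"
    then show ?thesis by simp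
  next
    assume j: "k = 2 * j + 1"
    have "\<lceil>real k / 2\<rceil> = int j + 1" by (rule ceiling_unique) (simp_all add: j field_simps)
    then show ?thesis by (simp add: j)
  qed
  then show ?thesis by (simp add: k)
qed

theorem theorem1p9:
  fixes r n :: nat
    and G :: "'a pair_pre_digraph"
    and K D :: "(nat + nat) pair_pre_digraph"
    and \<rho>' \<rho>'' :: real
  assumes "r \<ge> 1"
    and "n \<ge> r^2 + r + 2"
    and "pair_graph G"
    and "card (pverts G) = n"
    and "bipartite G"
    and "no_isolated_vertices G"
    and "binding_number G < 1 / real r"
    and "K = complete_bipartite_graph
               (n - nat \<lfloor>(real n - 1) / (real r + 1)\<rfloor>) (nat \<lfloor>(real n - 1) / (real r + 1)\<rfloor>)"
    and "D = double_nested_graph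
               (nat \<lceil>(real n - real r - 1) / 2\<rceil>) (r + 1) 1 (nat \<lfloor>(real n - real r - 1) / 2\<rfloor> - 1)"
    and "\<rho>' = graph_rho K"
    and "\<rho>'' = graph_rho D"
  shows "(r = 1 \<longrightarrow>
            graph_rho G \<le> \<rho>' \<and> (graph_rho G = \<rho>' \<longleftrightarrow> graph_iso G K)) \<and>
         (r \<ge> 2 \<and> \<rho>' > \<rho>'' \<longrightarrow>
            graph_rho G \<le> \<rho>' \<and> (graph_rho G = \<rho>' \<longleftrightarrow> graph_iso G K)) \<and>
         (r \<ge> 2 \<and> \<rho>' < \<rho>'' \<longrightarrow>
            graph_rho G \<le> \<rho>'' \<and> (graph_rho G = \<rho>'' \<longleftrightarrow> graph_iso G D)) \<and>
         (r \<ge> 2 \<and> \<rho>' = \<rho>'' \<longrightarrow>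
            graph_rho G \<le> \<rho>' \<and> (graph_rho G = \<rho>' \<longleftrightarrow> graph_iso G K \<or> graph_iso G D))"
proof -
  have n: "n \<ge> 1" "n \<ge> r + 1" and ne: "pverts G \<noteq> {}" using assms(2,4) by auto
  have isoK: "graph_iso G K \<Longrightarrow> graph_rho G = \<rho>'"
    using graph_rho_iso[OF assms(3) _ ne, of K] pair_graph_complete_bipartite_graph assms(8,10) by simp
  have isoD: "graph_iso G D \<Longrightarrow> graph_rho G = \<rho>''"
    using graph_rho_iso[OF assms(3) _ ne, of D] pair_graph_double_nested_graph assms(9,11) by simp
  \<comment> \<open>An isomorphism fixes the value of \<open>graph_rho G\<close> and the other
    alternatives are strict, so comparing \<open>\<rho>'\<close> with \<open>\<rho>''\<close>
    settles both the bound and the equality case of each part.\<close>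
  have "graph_iso G K \<or> graph_rho G < \<rho>' \<or> r \<ge> 2 \<and> (graph_iso G D \<or> graph_rho G < \<rho>'')"
    using graph_rho_bound[OF assms(1-7)]
    unfolding assms(8-11) nat_floor_divide[OF n(1)] nat_floor_half[OF n(2)] nat_ceiling_half[OF n(2)] .
  then show ?thesis using isoK isoD by fastforce
qed

end
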